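(* Let $u_1,u_2\ge 1$ and $\gamma>1$. Consider the problem of steering the system $\dot x_1=x_2$, $\dot x_2=-u x_1+1/x_1^3$ (with $x_1>0$) from $(1,0)$ to $(\gamma,0)$ in minimum time by Lebesgue measurable controls $u$ with values in $[-u_1,u_2]$. For the candidate optimal trajectories (described in the context) the following holds. (a) Starting from $(1,0)$, the necessary time to reach the target point $(\gamma,0)$ with one switching is $$T_{0}=\frac{1}{\sqrt{u_{1}}}\sinh^{-1}\left(\sqrt{\frac{u_{1}(\gamma^{2}-1)(u_{2}\gamma^{2}-1)}{\gamma^{2}(u_{1}+u_{2})(u_{1}+1)}}\right)+\frac{1}{\sqrt{u_{2}}}\sin^{-1}\left(\sqrt{\frac{u_{2}(\gamma^{2}-1)(u_{1}\gamma^{2}+1)}{(u_{1}+u_{2})(u_{2}\gamma^{4}-1)}}\right).$$ (b) The necessary time to reach the target with $n$ turns ($2n$ switchings) is $$T_{n}=T_{I}+nT_{X}+(n-1)T_{Y}+T_{F},$$ where $$T_{I}=\frac{1}{2\sqrt{u_{2}}}\cos^{-1}\left(-\frac{sc_{1}+u_{2}\sqrt{c_{1}^{2}-4(s+u_{2})}}{(s+u_{2})\sqrt{c_{1}^{2}-4u_{2}}}\right),$$ $$T_{F}=\frac{1}{2\sqrt{u_{2}}}\cos^{-1}\left(\frac{-sc_{n+1}+u_{2}\sqrt{c_{n+1}^{2}-4(s+u_{2})}}{(s+u_{2})\sqrt{c_{n+1}^{2}-4u_{2}}}\right),$$ $$T_{X}=T_X(s)=\frac{1}{2\sqrt{u_{1}}}\cosh^{-1}\left(\frac{s+u_{1}}{s-u_{1}}\right),\qquad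 T_{Y}=\frac{1}{2\sqrt{u_{2}}}\left(2\pi-\cos^{-1}\left(\frac{s-u_{2}}{s+u_{2}}\right)\right),$$ $$c_{1}=u_{2}+1,\qquad c_{n+1}=u_{2}\gamma^{2}+\frac{1}{\gamma^{2}},$$ and $s$ is the solution of the transcendental equation $$\frac{c_{1}+\sqrt{c_{1}^{2}-4(s+u_{2})}}{c_{n+1}+\sqrt{c_{n+1}^{2}-4(s+u_{2})}}=\left(\frac{s-u_{1}}{s+u_{2}}\right)^{n}$$ in the interval $u_{1}<s\leq(u_{2}-1)^{2}/4$. The constants $c_1$ and $c_{n+1}$ characterize the first and the last $Y$-segments, respectively, of the trajectory. (c) The number of turns satisfies the inequality $$n\leq\left[\frac{T_0}{T_X(s_+)}\right],\qquad s_+=\frac{(u_{2}-1)^{2}}{4},$$ where $[\,\cdot\,]$ denotes the integer part.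
   Context: The state space is $\mathcal D=\{(x_1,x_2)\in\mathbb R^2: x_1>0\}$. An $X$-segment is a piece of trajectory corresponding to the constant control $u\equiv -u_1$; a $Y$-segment is a piece of trajectory corresponding to the constant control $u\equiv u_2$. $XY$ denotes the concatenation of an $X$-segment followed by a $Y$-segment, and similarly for longer words. A switching is a change of the control between the values $-u_1$ and $u_2$; a switching point is the state at which it occurs. The candidate optimal trajectories from $(1,0)$ to $(\gamma,0)$ are the bang-bang trajectories left by the necessary conditions for optimality: they have either the one-switching form $XY$ (zero turns), or the spiral form $YX\ldots YXY$ with an even number of switchings; along the latter, the ratio $x_2/x_1$ at consecutive switching points has constant magnitude and alternating sign, and consecutive switching points are not mirror images of each other in the $x_1$-axis. A trajectory with $n\ge 1$ turns is one of the spiral form with exactly $2n$ switchings, i.e. $n+1$ $Y$-segments alternating with $n$ $X$-segments. The number $s$ is the common value of $x_2^2/x_1^2$ at the switching points. $T_I$ and $T_F$ are the times along the initial segment (from the starting point to the first switching) and the final segment (from the last switching to the target), and $T_X$, $T_Y$ are the times along each intermediate $X$- and $Y$-segment. The constants $c_1$ and $c_{n+1}$ are the values of the first integral $x_2^2+u_2x_1^2+1/x_1^2$ (constant along $Y$-segments) on the first and the last $Y$-segment. An $n$-turn candidate need not be optimal: the times $T_n$ for different $n$ are to be compared with each other to obtain the minimum time.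
   Formalization: Segments may not revisit a state (no full extra revolutions); in (b) the equation for s, T_I and T_n are claimed only when the first switching is at the inner point (x_1^2 ≤ 2/c_1), as they fail otherwise; (c) is claimed only for candidates taking time at most T_0, since it fails for slower ones. *)

theory Defs
  imports "HOL-Analysis.Analysis"
begin

section \<open>The control system\<close>

definition state_space :: "(real \<times> real) set" where
  "state_space = {p. fst p > 0}"

definition dynamics :: "real \<Rightarrow> real \<times> real \<Rightarrow> real \<times> real" where
  "dynamics a p = (snd p, - a * fst p + 1 / fst p ^ 3)"

definition admissible_control :: "real \<Rightarrow> real \<Rightarrow> real \<Rightarrow> (real \<Rightarrow> real) \<Rightarrow> bool" where
  "admissible_control u1 u2 T u \<longleftrightarrow>
     u \<in> borel_measurable (lebesgue_on {0..T}) \<and> (\<forall>t\<in>{0..T}. - u1 \<le> u t \<and> u t \<le> u2)"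

text \<open>As the control is only measurable, the differential equation is required in integrated
  (Caratheodory) form.\<close>

definition steers ::
  "real \<Rightarrow> real \<Rightarrow> real \<Rightarrow> (real \<Rightarrow> real) \<Rightarrow> (real \<Rightarrow> real \<times> real) \<Rightarrow> real \<times> real \<Rightarrow> real \<times> real \<Rightarrow> bool"
where
  "steers u1 u2 T u x p q \<longleftrightarrow>
     0 \<le> T \<and> admissible_control u1 u2 T u \<and> x 0 = p \<and> x T = q \<and>
     (\<forall>t\<in>{0..T}. x t \<in> state_space \<and>
        ((\<lambda>r. dynamics (u r) (x r)) has_integral (x t - x 0)) {0..t})"

section \<open>Candidate trajectories\<close>

text \<open>A bang-bang trajectory from \<open>(1,0)\<close> to \<open>(\<gamma>,0)\<close> with \<open>m\<close> switchings: the switching times are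
  \<open>\<tau> 1 < \<dots> < \<tau> m\<close>, with \<open>\<tau> 0 = 0\<close> and final time \<open>\<tau> (Suc m)\<close>, and the control is \<open>v i\<close> on the
  \<open>i\<close>-th segment (its values at the isolated times \<open>\<tau> i\<close> are irrelevant).
  A segment must not return to a state it has visited. The orbits of the control \<open>u2\<close> are closed
  curves, so otherwise superfluous full revolutions could be inserted; cutting out such a
  loop shortens the time, so minimum-time trajectories contain none.\<close>

definition bang_bang ::
  "real \<Rightarrow> real \<Rightarrow> real \<Rightarrow> nat \<Rightarrow> (nat \<Rightarrow> real) \<Rightarrow> (nat \<Rightarrow> real) \<Rightarrow> (real \<Rightarrow> real) \<Rightarrow> (real \<Rightarrow> real \<times> real) \<Rightarrow> bool"
where
  "bang_bang u1 u2 \<gamma> m v \<tau> u x \<longleftrightarrow>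
     \<tau> 0 = 0 \<and> (\<forall>i\<le>m. \<tau> i < \<tau> (Suc i)) \<and>
     steers u1 u2 (\<tau> (Suc m)) u x (1, 0) (\<gamma>, 0) \<and>
     (\<forall>i\<le>m. (\<forall>t\<in>{\<tau> i<..<\<tau> (Suc i)}. u t = v i) \<and> inj_on x {\<tau> i..\<tau> (Suc i)})"

definition XY_trajectory ::
  "real \<Rightarrow> real \<Rightarrow> real \<Rightarrow> (nat \<Rightarrow> real) \<Rightarrow> (real \<Rightarrow> real) \<Rightarrow> (real \<Rightarrow> real \<times> real) \<Rightarrow> bool"
where
  "XY_trajectory u1 u2 \<gamma> \<tau> u x \<longleftrightarrow>
     bang_bang u1 u2 \<gamma> 1 (\<lambda>i. if even i then - u1 else u2) \<tau> u x"

definition slope :: "real \<times> real \<Rightarrow> real" where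
  "slope p = snd p / fst p"

definition mirror :: "real \<times> real \<Rightarrow> real \<times> real" where
  "mirror p = (fst p, - snd p)"

text \<open>The spiral form \<open>YX\<dots>YXY\<close> with \<open>2n\<close> switchings, where \<open>s\<close> is the common value of
  \<open>x2\<^sup>2/x1\<^sup>2\<close> at the switching points.\<close>

definition turn_trajectory ::
  "real \<Rightarrow> real \<Rightarrow> real \<Rightarrow> nat \<Rightarrow> real \<Rightarrow> (nat \<Rightarrow> real) \<Rightarrow> (real \<Rightarrow> real) \<Rightarrow> (real \<Rightarrow> real \<times> real) \<Rightarrow> bool"
where
  "turn_trajectory u1 u2 \<gamma> n s \<tau> u x \<longleftrightarrow>
     n \<ge> 1 \<and>
     bang_bang u1 u2 \<gamma> (2 * n) (\<lambda>i. if even i then u2 else - u1) \<tau> u x \<and>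
     (\<forall>i\<in>{1..2 * n}. (slope (x (\<tau> i)))\<^sup>2 = s) \<and>
     (\<forall>i\<in>{1..<2 * n}. slope (x (\<tau> i)) * slope (x (\<tau> (Suc i))) < 0 \<and>
        x (\<tau> (Suc i)) \<noteq> mirror (x (\<tau> i)))"

definition Y_first_integral :: "real \<Rightarrow> real \<times> real \<Rightarrow> real" where
  "Y_first_integral u2 p = (snd p)\<^sup>2 + u2 * (fst p)\<^sup>2 + 1 / (fst p)\<^sup>2"

section \<open>The explicit formulas\<close>

definition T_zero :: "real \<Rightarrow> real \<Rightarrow> real \<Rightarrow> real" where
  "T_zero u1 u2 \<gamma> =
     1 / sqrt u1 * arsinh (sqrt (u1 * (\<gamma>\<^sup>2 - 1) * (u2 * \<gamma>\<^sup>2 - 1) / (\<gamma>\<^sup>2 * (u1 + u2) * (u1 + 1)))) +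
     1 / sqrt u2 * arcsin (sqrt (u2 * (\<gamma>\<^sup>2 - 1) * (u1 * \<gamma>\<^sup>2 + 1) / ((u1 + u2) * (u2 * \<gamma> ^ 4 - 1))))"

definition c_first :: "real \<Rightarrow> real" where
  "c_first u2 = u2 + 1"

definition c_last :: "real \<Rightarrow> real \<Rightarrow> real" where
  "c_last u2 \<gamma> = u2 * \<gamma>\<^sup>2 + 1 / \<gamma>\<^sup>2"

definition s_plus :: "real \<Rightarrow> real" where
  "s_plus u2 = (u2 - 1)\<^sup>2 / 4"

definition T_I :: "real \<Rightarrow> real \<Rightarrow> real" where
  "T_I u2 s = (let c = c_first u2 in
     1 / (2 * sqrt u2) *
       arccos (- ((s * c + u2 * sqrt (c\<^sup>2 - 4 * (s + u2))) / ((s + u2) * sqrt (c\<^sup>2 - 4 * u2)))))"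

definition T_F :: "real \<Rightarrow> real \<Rightarrow> real \<Rightarrow> real" where
  "T_F u2 \<gamma> s = (let c = c_last u2 \<gamma> in
     1 / (2 * sqrt u2) *
       arccos ((- s * c + u2 * sqrt (c\<^sup>2 - 4 * (s + u2))) / ((s + u2) * sqrt (c\<^sup>2 - 4 * u2))))"

definition T_X :: "real \<Rightarrow> real \<Rightarrow> real" where
  "T_X u1 s = 1 / (2 * sqrt u1) * arcosh ((s + u1) / (s - u1))"

definition T_Y :: "real \<Rightarrow> real \<Rightarrow> real" where
  "T_Y u2 s = 1 / (2 * sqrt u2) * (2 * pi - arccos ((s - u2) / (s + u2)))"

definition T_turns :: "real \<Rightarrow> real \<Rightarrow> real \<Rightarrow> nat \<Rightarrow> real \<Rightarrow> real" where
  "T_turns u1 u2 \<gamma> n s =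
     T_I u2 s + real n * T_X u1 s + (real n - 1) * T_Y u2 s + T_F u2 \<gamma> s"

definition turn_equation :: "real \<Rightarrow> real \<Rightarrow> real \<Rightarrow> nat \<Rightarrow> real \<Rightarrow> bool" where
  "turn_equation u1 u2 \<gamma> n s \<longleftrightarrow>
     (let c = c_first u2; c' = c_last u2 \<gamma> in
        u1 < s \<and> s \<le> s_plus u2 \<and>
        (c + sqrt (c\<^sup>2 - 4 * (s + u2))) / (c' + sqrt (c'\<^sup>2 - 4 * (s + u2)))
          = ((s - u1) / (s + u2)) ^ n)"

text \<open>On the \<open>Y\<close>-orbit leaving \<open>(1,0)\<close> one has \<open>x2\<^sup>2/x1\<^sup>2 = c/x1\<^sup>2 - u2 - 1/x1\<^sup>4\<close> with \<open>c = c_first u2\<close>,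
  which grows until \<open>x1\<^sup>2 = 2/c\<close>, where it equals \<open>s_plus u2\<close>, and then decreases. Hence
  the orbit meets a ray \<open>x2 = - sqrt s * x1\<close> in two points when \<open>s < s_plus u2\<close>. The following
  predicate on the first switching point selects the later, inner one of the two; this is the
  one underlying the formula for \<open>T_I\<close> and the equation for \<open>s\<close>.\<close>

definition inner_first_switching :: "real \<Rightarrow> real \<times> real \<Rightarrow> bool" where
  "inner_first_switching u2 p \<longleftrightarrow> (fst p)\<^sup>2 \<le> 2 / c_first u2"

end

theory Submission
  imports Defs
begin

text \<open>
  Put \<open>q = x1\<^sup>2\<close> and \<open>m = x1 * x2\<close>. Under a constant control \<open>a\<close> the quantity
  \<open>E = x2\<^sup>2 + a * x1\<^sup>2 + 1 / x1\<^sup>2\<close> is constant, and the system becomes linear in these coordinates: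
  \<open>q' = 2 * m\<close> and \<open>m' = E - 2 * a * q\<close>. So \<open>(q - E / (2 * a), m / sqrt \<bar>a\<bar>)\<close> performs a rotation (for \<open>a > 0\<close>) or a
  hyperbolic rotation (for \<open>a < 0\<close>) with rate \<open>2 * sqrt \<bar>a\<bar>\<close>, and the time needed between two states
  of one orbit is an inverse trigonometric or hyperbolic function of their coordinates
  (\<open>flow_eq_iff_angle\<close>). All the times of the theorem are instances of this. A trajectory given in
  integrated form follows this explicit flow on each segment (\<open>steers_flow\<close>), and conversely
  flows that fit together at their end points form a trajectory (\<open>bang_bang_exists\<close>).

  With one switching, the switching point is determined by the first integrals of the two orbits,
  the \<open>X\<close>-orbit through the start and the \<open>Y\<close>-orbit through the target.

  For spirals, an orbit with first integral \<open>E\<close> meets the rays \<open>x2\<^sup>2 = s * x1\<^sup>2\<close> where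
  \<open>(s + a) * q + 1 / q = E\<close>. The two roots have product \<open>1 / (s + a)\<close>, and two consecutive switching
  points must realise different roots, since otherwise they are mirror images. Therefore
  \<open>q * q' = 1 / (s + a)\<close>; the angle between them then depends on \<open>s\<close> and \<open>a\<close> only (\<open>slope_transit\<close>), which
  yields \<open>T_X\<close> and \<open>T_Y\<close>. Multiplying these relations along the spiral connects the first and the last
  switching point through the \<open>n\<close>-th power of \<open>(s - u1) / (s + u2)\<close>, whereas the first integrals of the
  first and last segments express these two points as roots of quadratic equations. Because
  \<open>c_first u2 < c_last u2 \<gamma>\<close>, the last switching point is always the outer root (\<open>last_switching_outer\<close>), so
  the transcendental equation holds precisely if the first one is the inner root (\<open>turn_equation_iff\<close>).

  The equation has at most one solution because its left side decreases with \<open>s\<close> while its right side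
  increases strictly (\<open>root_ratio_antimono\<close>, \<open>turn_equation_not_less\<close>). Given a solution, the switching points
  are written down explicitly, and every two consecutive ones lie on one orbit
  (\<open>turn_trajectory_exists\<close>). The bound on \<open>n\<close> holds since the \<open>n\<close> \<open>X\<close>-segments alone take time
  \<open>n * T_X u1 s\<close>, and \<open>T_X\<close> decreases with \<open>s \<le> s_plus u2\<close>.
\<close>

section \<open>The flow of a constant control\<close>

text \<open>For \<open>a \<noteq> 0\<close>, \<open>gcos a\<close> and \<open>gsin a\<close> are the solutions of \<open>y'' = - 4 * a * y\<close> with initial values \<open>(1, 0)\<close> and
  \<open>(0, 2)\<close>. They allow the \<open>X\<close>-flow (\<open>a = - u1\<close>) and the \<open>Y\<close>-flow (\<open>a = u2\<close>) to be treated at once.\<close>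
definition gcos :: "real \<Rightarrow> real \<Rightarrow> real" where
  "gcos a t = (if a > 0 then cos (2 * sqrt a * t) else cosh (2 * sqrt (- a) * t))"

definition gsin :: "real \<Rightarrow> real \<Rightarrow> real" where
  "gsin a t = (if a > 0 then sin (2 * sqrt a * t) / sqrt a else sinh (2 * sqrt (- a) * t) / sqrt (- a))"

lemma gcos_0 [simp]: "gcos a 0 = 1" and gsin_0 [simp]: "gsin a 0 = 0"
  by (auto simp: gcos_def gsin_def)

lemma gcos_gsin_identity:
  assumes "a \<noteq> 0" shows "(gcos a t)\<^sup>2 + a * (gsin a t)\<^sup>2 = 1"
proof (cases "a > 0")
  case True
  then show ?thesis by (simp add: gcos_def gsin_def power_divide)
next
  case False
  then have "a < 0" using assms by simp
  then show ?thesis by (simp add: gcos_def gsin_def power_divide cosh_square_eq)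
qed

lemma has_derivative_gcos:
  assumes "a \<noteq> 0"
  shows "((\<lambda>t. gcos a (t - b)) has_real_derivative - 2 * a * gsin a (t - b)) (at t within S)"
proof (cases "a > 0")
  case True
  define k where "k = sqrt a"
  have "k > 0" "a = k * k" using True by (auto simp: k_def)
  then show ?thesis using True unfolding gcos_def gsin_def k_def[symmetric]
    by (auto intro!: derivative_eq_intros)
next
  case False
  define k where "k = sqrt (- a)"
  have "k > 0" "a = - (k * k)" using False assms by (auto simp: k_def)
  then show ?thesis using False unfolding gcos_def gsin_def k_def[symmetric]
    by (auto intro!: derivative_eq_intros)
qed

lemma has_derivative_gsin:
  assumes "a \<noteq> 0"
  shows "((\<lambda>t. gsin a (t - b)) has_real_derivative 2 * gcos a (t - b)) (at t within S)"
proof (cases "a > 0")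
  case True
  define k where "k = sqrt a"
  have "k > 0" using True by (auto simp: k_def)
  then show ?thesis using True unfolding gcos_def gsin_def k_def[symmetric]
    by (auto intro!: derivative_eq_intros)
next
  case False
  define k where "k = sqrt (- a)"
  have "k > 0" using False assms by (auto simp: k_def)
  then show ?thesis using False unfolding gcos_def gsin_def k_def[symmetric]
    by (auto intro!: derivative_eq_intros)
qed

text \<open>The square of \<open>x1\<close> relative to the centre \<open>E / (2 * a)\<close> about which it oscillates along the
  orbit if \<open>a > 0\<close>; if \<open>a < 0\<close>, the motion relative to this value combines \<open>cosh\<close> and \<open>sinh\<close>.\<close>
definition offset :: "real \<Rightarrow> real \<times> real \<Rightarrow> real" where
  "offset a p = (fst p)\<^sup>2 - Y_first_integral a p / (2 * a)"

text \<open>Half the time derivative of \<open>x1\<^sup>2\<close>.\<close>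
definition momentum :: "real \<times> real \<Rightarrow> real" where
  "momentum p = fst p * snd p"

text \<open>The solution of the linear system \<open>q' = 2 * m\<close>, \<open>m' = E - 2 * a * q\<close> that starts at the
  coordinates \<open>q = x1\<^sup>2\<close>, \<open>m = x1 * x2\<close> of the state \<open>p\<close>; \<open>sqflow\<close> gives \<open>q\<close> and \<open>momflow\<close> gives \<open>m\<close>.\<close>
definition sqflow :: "real \<Rightarrow> real \<Rightarrow> real \<times> real \<Rightarrow> real" where
  "sqflow a t p = Y_first_integral a p / (2 * a) + offset a p * gcos a t + momentum p * gsin a t"

definition momflow :: "real \<Rightarrow> real \<Rightarrow> real \<times> real \<Rightarrow> real" where
  "momflow a t p = momentum p * gcos a t - a * offset a p * gsin a t"

definition flow :: "real \<Rightarrow> real \<Rightarrow> real \<times> real \<Rightarrow> real \<times> real" where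
  "flow a t p = (sqrt (sqflow a t p), momflow a t p / sqrt (sqflow a t p))"

text \<open>The coordinates \<open>q\<close> and \<open>m\<close> of a state are tied to the first integral by this quadratic
  relation. It is what allows the state to be recovered from the solution of the linear system.\<close>
lemma first_integral_mult:
  assumes "fst p > 0"
  shows "(fst p)\<^sup>2 * (Y_first_integral a p - a * (fst p)\<^sup>2) - (momentum p)\<^sup>2 = 1"
  using assms by (simp add: Y_first_integral_def momentum_def field_simps)

lemma offset_norm:
  assumes "fst p > 0" "a \<noteq> 0"
  shows "(offset a p)\<^sup>2 + (momentum p)\<^sup>2 / a = (Y_first_integral a p)\<^sup>2 / (4 * a\<^sup>2) - 1 / a"
proof -
  define E where "E = Y_first_integral a p"
  define q where "q = (fst p)\<^sup>2"
  have m: "(momentum p)\<^sup>2 = q * (E - a * q) - 1"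
    using first_integral_mult[OF assms(1), of a] by (simp add: E_def q_def)
  have "(q - E / (2 * a))\<^sup>2 = q\<^sup>2 - q * E / a + E\<^sup>2 / (4 * a\<^sup>2)"
    by (simp add: power2_diff power_divide power_mult_distrib)
  moreover have "(q * (E - a * q) - 1) / a = q * E / a - q\<^sup>2 - 1 / a"
    using assms(2) by (simp add: field_simps power2_eq_square)
  ultimately show ?thesis unfolding m offset_def E_def[symmetric] q_def[symmetric] by simp
qed

lemma sqflow_momflow:
  assumes "fst p > 0" "a \<noteq> 0"
  shows "sqflow a t p * (Y_first_integral a p - a * sqflow a t p) - (momflow a t p)\<^sup>2 = 1"
proof -
  define E where "E = Y_first_integral a p"
  define A where "A = offset a p"
  define m where "m = momentum p"
  define C where "C = gcos a t"
  define S where "S = gsin a t"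
  have N: "A\<^sup>2 + m\<^sup>2 / a = E\<^sup>2 / (4 * a\<^sup>2) - 1 / a"
    using offset_norm[OF assms] by (simp add: A_def m_def E_def)
  have N': "a * A\<^sup>2 + m\<^sup>2 = E\<^sup>2 / (4 * a) - 1"
  proof -
    have "a * A\<^sup>2 + m\<^sup>2 = a * (A\<^sup>2 + m\<^sup>2 / a)" using assms(2) by (simp add: field_simps)
    also have "\<dots> = E\<^sup>2 / (4 * a) - 1"
      unfolding N using assms(2) by (simp add: field_simps power2_eq_square)
    finally show ?thesis .
  qed
  have CS: "C\<^sup>2 + a * S\<^sup>2 = 1"
    using gcos_gsin_identity[OF assms(2)] by (simp add: C_def S_def)
  have "(E / (2 * a) + A * C + m * S) * (E - a * (E / (2 * a) + A * C + m * S)) - (m * C - a * A * S)\<^sup>2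
      = E\<^sup>2 / (4 * a) - (a * A\<^sup>2 + m\<^sup>2) * (C\<^sup>2 + a * S\<^sup>2)"
    using assms(2) by (simp add: field_simps power2_eq_square)
  also have "\<dots> = 1" unfolding N' CS by simp
  finally show ?thesis
    by (simp add: sqflow_def momflow_def E_def A_def m_def C_def S_def)
qed

lemma sqflow_0: "sqflow a 0 p = (fst p)\<^sup>2" 
  and momflow_0: "momflow a 0 p = momentum p"
  by (simp_all add: sqflow_def momflow_def offset_def)

lemma has_derivative_sqflow:
  assumes "a \<noteq> 0"
  shows "((\<lambda>t. sqflow a (t - b) p) has_real_derivative 2 * momflow a (t - b) p) (at t within S)"
  unfolding sqflow_def momflow_def
  by (auto intro!: derivative_eq_intros has_derivative_gcos[OF assms] has_derivative_gsin[OF assms]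
      simp: algebra_simps)

lemma has_derivative_momflow:
  assumes "a \<noteq> 0"
  shows "((\<lambda>t. momflow a (t - b) p) has_real_derivative
    Y_first_integral a p - 2 * a * sqflow a (t - b) p) (at t within S)"
  unfolding sqflow_def momflow_def
  by (auto intro!: derivative_eq_intros has_derivative_gcos[OF assms] has_derivative_gsin[OF assms]
      simp: algebra_simps assms)

text \<open>By \<open>sqflow_momflow\<close> the function \<open>sqflow\<close> never vanishes, so it keeps the sign that it has at time \<open>0\<close>.
  This is why the state stays in the half plane \<open>x1 > 0\<close>.\<close>
lemma sqflow_pos:
  assumes "fst p > 0" "a \<noteq> 0"
  shows "sqflow a t p > 0"
proof (rule ccontr)
  assume "\<not> ?thesis"
  moreover have "0 < sqflow a 0 p" using assms by (simp add: sqflow_0)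
  moreover have "continuous_on UNIV (\<lambda>t. sqflow a (t - 0) p)"
    by (rule DERIV_continuous_on[OF has_derivative_sqflow[OF assms(2)]])
  then have "connected (range (\<lambda>t. sqflow a t p))"
    by (intro connected_continuous_image) auto
  ultimately have "0 \<in> range (\<lambda>t. sqflow a t p)"
    using connectedD_interval[of "range (\<lambda>t. sqflow a t p)" "sqflow a t p" "sqflow a 0 p" 0] by auto
  then obtain t' where "sqflow a t' p = 0" by force
  with sqflow_momflow[OF assms, of t'] have "- ((momflow a t' p)\<^sup>2) = 1" by simp
  then show False by (smt (verit) zero_le_power2)
qed

lemma fst_flow_pos: "fst p > 0 \<Longrightarrow> a \<noteq> 0 \<Longrightarrow> fst (flow a t p) > 0"
  by (simp add: flow_def sqflow_pos)

lemma flow_0: "fst p > 0 \<Longrightarrow> flow a 0 p = p"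
  by (simp add: flow_def sqflow_0 momflow_0 momentum_def prod_eq_iff)

lemma flow_eq_iff:
  assumes "fst p > 0" "fst p' > 0" "a \<noteq> 0"
  shows "flow a t p = p' \<longleftrightarrow> sqflow a t p = (fst p')\<^sup>2 \<and> momflow a t p = momentum p'"
proof
  assume "flow a t p = p'"
  then show "sqflow a t p = (fst p')\<^sup>2 \<and> momflow a t p = momentum p'"
    using sqflow_pos[OF assms(1,3), of t] by (auto simp: flow_def momentum_def)
next
  assume "sqflow a t p = (fst p')\<^sup>2 \<and> momflow a t p = momentum p'"
  then show "flow a t p = p'"
    using assms by (simp add: flow_def momentum_def prod_eq_iff)
qed

lemma first_integral_flow:
  assumes "fst p > 0" "a \<noteq> 0"
  shows "Y_first_integral a (flow a t p) = Y_first_integral a p"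
proof -
  define q where "q = sqflow a t p"
  have q: "q > 0" unfolding q_def by (rule sqflow_pos[OF assms])
  have "Y_first_integral a (flow a t p) = (momflow a t p)\<^sup>2 / q + a * q + 1 / q"
    using q by (simp add: Y_first_integral_def flow_def power_divide flip: q_def)
  also have "\<dots> = ((momflow a t p)\<^sup>2 + a * q\<^sup>2 + 1) / q"
    using q by (simp add: add_divide_distrib power2_eq_square)
  also have "(momflow a t p)\<^sup>2 + a * q\<^sup>2 + 1 = Y_first_integral a p * q"
    using sqflow_momflow[OF assms, of t] by (simp add: algebra_simps power2_eq_square flip: q_def)
  finally show ?thesis using q by simp
qed

lemma flow_solves:
  assumes "fst p > 0" "a \<noteq> 0"
  shows "((\<lambda>t. flow a (t - b) p) has_vector_derivative dynamics a (flow a (t - b) p)) (at t within S)"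
proof -
  define q where "q = sqflow a (t - b) p"
  define m where "m = momflow a (t - b) p"
  define E where "E = Y_first_integral a p"
  have q: "q > 0" unfolding q_def by (rule sqflow_pos[OF assms])
  have qm: "q * (E - a * q) - m\<^sup>2 = 1"
    unfolding q_def m_def E_def by (rule sqflow_momflow[OF assms])
  have s2: "sqrt q * sqrt q = q" using q by simp
  have 1: "((\<lambda>t. sqrt (sqflow a (t - b) p)) has_real_derivative m / sqrt q) (at t within S)"
    using q unfolding q_def m_def
    by (auto intro!: derivative_eq_intros has_derivative_sqflow[OF assms(2)] simp: field_simps)
  have "((\<lambda>t. momflow a (t - b) p / sqrt (sqflow a (t - b) p)) has_real_derivative
      ((E - 2 * a * q) * sqrt q - m * (m / sqrt q)) / (sqrt q * sqrt q)) (at t within S)"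
    using q unfolding q_def m_def E_def
    by (intro DERIV_divide 1[unfolded m_def q_def] has_derivative_momflow[OF assms(2)]) auto
  moreover have "((E - 2 * a * q) * sqrt q - m * (m / sqrt q)) / (sqrt q * sqrt q)
      = - a * sqrt q + 1 / sqrt q ^ 3"
  proof -
    have "((E - 2 * a * q) * sqrt q - m * (m / sqrt q)) / (sqrt q * sqrt q)
      = ((E - 2 * a * q) * (sqrt q * sqrt q) - m\<^sup>2) / sqrt q ^ 3"
      using q by (simp add: field_simps power2_eq_square power3_eq_cube)
    also have "(E - 2 * a * q) * (sqrt q * sqrt q) - m\<^sup>2 = 1 - a * q\<^sup>2"
      using qm unfolding s2 by (simp add: algebra_simps power2_eq_square)
    also have "q\<^sup>2 = sqrt q ^ 4" using s2 by (simp add: power4_eq_xxxx power2_eq_square)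
    also have "(1 - a * sqrt q ^ 4) / sqrt q ^ 3 = - a * sqrt q + 1 / sqrt q ^ 3"
      using q by (simp add: field_simps power4_eq_xxxx power3_eq_cube)
    finally show ?thesis .
  qed
  ultimately have 2: "((\<lambda>t. momflow a (t - b) p / sqrt (sqflow a (t - b) p)) has_real_derivative
      (- a * sqrt q + 1 / sqrt q ^ 3)) (at t within S)" by simp
  show ?thesis
    using has_vector_derivative_Pair[OF 1[unfolded has_real_derivative_iff_has_vector_derivative]
        2[unfolded has_real_derivative_iff_has_vector_derivative]]
    by (simp add: flow_def dynamics_def q_def m_def)
qed

text \<open>Uniqueness of solutions follows by undoing the rotation: the coordinates of \<open>x t\<close>, rotated
  back by the angle belonging to time \<open>t - b\<close>, have derivative zero, and so has the first integral.\<close>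
lemma solution_is_flow:
  assumes "a \<noteq> 0" and "\<And>t. t \<in> {b..c} \<Longrightarrow> fst (x t) > 0"
    and ode: "\<And>t. t \<in> {b..c} \<Longrightarrow> (x has_vector_derivative dynamics a (x t)) (at t within {b..c})"
    and t: "t \<in> {b..c}"
  shows "x t = flow a (t - b) (x b)"
proof -
  have b: "b \<in> {b..c}" using t by auto
  have 1: "((\<lambda>t. fst (x t)) has_real_derivative snd (x t)) (at t within {b..c})"
    and 2: "((\<lambda>t. snd (x t)) has_real_derivative - a * fst (x t) + 1 / fst (x t) ^ 3) (at t within {b..c})"
    if "t \<in> {b..c}" for t
    using bounded_linear.has_vector_derivative[OF bounded_linear_fst ode[OF that]]
      bounded_linear.has_vector_derivative[OF bounded_linear_snd ode[OF that]]
    by (simp_all add: dynamics_def has_real_derivative_iff_has_vector_derivative)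
  have const: "f t = f b"
    if zero: "\<And>t. t \<in> {b..c} \<Longrightarrow> (f has_real_derivative 0) (at t within {b..c})" for f :: "real \<Rightarrow> real"
  proof -
    obtain d where "\<forall>t\<in>{b..c}. f t = d"
      using has_field_derivative_zero_constant[OF convex_real_interval(5), of b c f] zero by blast
    then show ?thesis using b t by simp
  qed
  let ?E = "\<lambda>t. Y_first_integral a (x t)"
  let ?A = "\<lambda>t. offset a (x t)"
  let ?m = "\<lambda>t. momentum (x t)"
  have dE: "(?E has_real_derivative 0) (at t within {b..c})" if "t \<in> {b..c}" for t
    unfolding Y_first_integral_def using assms(2)[OF that]
    by (auto intro!: derivative_eq_intros 1[OF that] 2[OF that]
        simp: field_simps power2_eq_square power3_eq_cube)
  have dA: "(?A has_real_derivative 2 * ?m t) (at t within {b..c})" if "t \<in> {b..c}" for t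
    unfolding offset_def momentum_def using assms(1) assms(2)[OF that]
    by (auto intro!: derivative_eq_intros 1[OF that] dE[OF that] simp: mult_ac)
  have dm: "(?m has_real_derivative - 2 * a * ?A t) (at t within {b..c})" if "t \<in> {b..c}" for t
    unfolding offset_def momentum_def Y_first_integral_def using assms(1) assms(2)[OF that]
    by (auto intro!: derivative_eq_intros 1[OF that] 2[OF that]
        simp: field_simps power2_eq_square power3_eq_cube)
  have dG: "((\<lambda>t. ?A t * gcos a (t - b) - ?m t * gsin a (t - b)) has_real_derivative 0) (at t within {b..c})"
    and dH: "((\<lambda>t. ?m t * gcos a (t - b) + a * ?A t * gsin a (t - b)) has_real_derivative 0) (at t within {b..c})"
    if "t \<in> {b..c}" for t
    by (auto intro!: derivative_eq_intros dA[OF that] dm[OF that] has_derivative_gcos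
        has_derivative_gsin assms(1) simp: algebra_simps)
  have G: "?A t * gcos a (t - b) - ?m t * gsin a (t - b) = ?A b"
    and H: "?m t * gcos a (t - b) + a * ?A t * gsin a (t - b) = ?m b"
    using const[OF dG] const[OF dH] by simp_all
  have E: "?E t = ?E b" using const[of ?E] dE by blast
  have CS: "(gcos a (t - b))\<^sup>2 + a * (gsin a (t - b))\<^sup>2 = 1"
    by (rule gcos_gsin_identity[OF assms(1)])
  have "?A b * gcos a (t - b) + ?m b * gsin a (t - b) =
     ?A t * ((gcos a (t - b))\<^sup>2 + a * (gsin a (t - b))\<^sup>2)"
    unfolding G[symmetric] H[symmetric] by (simp add: algebra_simps power2_eq_square)
  then have "sqflow a (t - b) (x b) = (fst (x t))\<^sup>2"
    unfolding CS sqflow_def by (simp add: offset_def E)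
  moreover have "?m b * gcos a (t - b) - a * ?A b * gsin a (t - b) =
     ?m t * ((gcos a (t - b))\<^sup>2 + a * (gsin a (t - b))\<^sup>2)"
    unfolding G[symmetric] H[symmetric] by (simp add: algebra_simps power2_eq_square)
  then have "momflow a (t - b) (x b) = ?m t" unfolding CS momflow_def by simp
  ultimately show ?thesis
    using flow_eq_iff[OF assms(2)[OF b] assms(2)[OF t] assms(1)] by metis
qed

section \<open>Trajectories as concatenated flows\<close>
lemma steers_refl:
  assumes "fst p > 0" "- u1 \<le> a" "a \<le> u2"
  shows "steers u1 u2 0 (\<lambda>_. a) (\<lambda>_. p) p p"
  using assms by (auto simp: steers_def admissible_control_def state_space_def)

lemma steers_pos: "steers u1 u2 T u x p q \<Longrightarrow> t \<in> {0..T} \<Longrightarrow> fst (x t) > 0"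
  by (simp add: steers_def state_space_def)

text \<open>The integrated equation on the new time interval is the fundamental theorem of calculus for
  the flow. It holds up to the switching time itself, a null set.\<close>
lemma steers_append_flow:
  assumes st: "steers u1 u2 T u x p q" and "d \<ge> 0" "a \<noteq> 0" "- u1 \<le> a" "a \<le> u2"
  shows "steers u1 u2 (T + d) (\<lambda>t. if t \<le> T then u t else a)
    (\<lambda>t. if t \<le> T then x t else flow a (t - T) q) p (flow a d q)"
    (is "steers _ _ _ ?u ?x _ _")
proof -
  have T: "T \<ge> 0" and q: "fst q > 0" and xT: "x T = q" and x0: "x 0 = p"
    and um: "u \<in> borel_measurable (lebesgue_on {0..T})"
    and ub: "\<And>t. t \<in> {0..T} \<Longrightarrow> - u1 \<le> u t \<and> u t \<le> u2"
    and pos: "\<And>t. t \<in> {0..T} \<Longrightarrow> fst (x t) > 0"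
    and int: "\<And>t. t \<in> {0..T} \<Longrightarrow> ((\<lambda>r. dynamics (u r) (x r)) has_integral (x t - x 0)) {0..t}"
    using st by (auto simp: steers_def admissible_control_def state_space_def)
  have "(\<lambda>t. (if t \<in> {0..T} then u t else 0) + indicator {T<..} t * a) \<in> borel_measurable lebesgue"
    by (intro borel_measurable_add borel_measurable_times borel_measurable_if_I um
        borel_measurable_indicator) auto
  then have "(\<lambda>t. (if t \<in> {0..T} then u t else 0) + indicator {T<..} t * a)
      \<in> borel_measurable (lebesgue_on {0..T + d})"
    by (rule measurable_restrict_space1)
  then have "?u \<in> borel_measurable (lebesgue_on {0..T + d})"
    by (subst measurable_cong[of _ ?u]) (auto simp: space_restrict_space)
  then have adm: "admissible_control u1 u2 (T + d) ?u"
    using ub assms by (auto simp: admissible_control_def)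
  have xflow: "?x t = flow a (t - T) q" if "t \<ge> T" for t
    using that xT flow_0[OF q] by (cases "t = T") auto
  have int': "((\<lambda>r. dynamics (?u r) (?x r)) has_integral (?x t - ?x 0)) {0..t}" if "t \<in> {0..T}" for t
  proof -
    have "((\<lambda>r. dynamics (?u r) (?x r)) has_integral (x t - x 0)) {0..t}"
      by (rule has_integral_eq[OF _ int[OF that]]) (use that in auto)
    then show ?thesis using that T by simp
  qed
  have int'': "((\<lambda>r. dynamics (?u r) (?x r)) has_integral (?x t - ?x 0)) {0..t}"
    if "t \<in> {T..T + d}" for t
  proof -
    have "((\<lambda>r. dynamics a (flow a (r - T) q)) has_integral (flow a (t - T) q - flow a (T - T) q)) {T..t}"
      using that by (intro fundamental_theorem_of_calculus flow_solves[OF q assms(3)]) auto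
    then have flow_int: "((\<lambda>r. dynamics a (flow a (r - T) q)) has_integral (flow a (t - T) q - q)) {T..t}"
      using flow_0[OF q, of a] by simp
    have "((\<lambda>r. dynamics (?u r) (?x r)) has_integral (flow a (t - T) q - q)) {T..t}"
      by (rule has_integral_spike_finite[OF _ _ flow_int, of "{T}"]) simp_all
    moreover have "T \<le> t" using that by simp
    ultimately have "((\<lambda>r. dynamics (?u r) (?x r)) has_integral (?x T - ?x 0 + (flow a (t - T) q - q))) {0..t}"
      using has_integral_combine[OF T _ int'[of T]] T by simp
    moreover have "?x T - ?x 0 + (flow a (t - T) q - q) = ?x t - ?x 0"
      unfolding xflow[OF \<open>T \<le> t\<close>] using xT by simp
    ultimately show ?thesis by (simp only:)
  qed
  have "fst (?x t) > 0" if "t \<in> {0..T + d}" for t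
    using pos[of t] fst_flow_pos[OF q assms(3)] that by simp
  moreover have "((\<lambda>r. dynamics (?u r) (?x r)) has_integral (?x t - ?x 0)) {0..t}" if "t \<in> {0..T + d}" for t
    using int'[of t] int''[of t] that by (cases "t \<le> T") (simp_all only: atLeastAtMost_iff, auto)
  moreover have "?x 0 = p" "?x (T + d) = flow a d q"
    using T x0 xflow[of "T + d"] assms(2) by simp_all
  ultimately show ?thesis
    using adm add_nonneg_nonneg[OF T assms(2)] unfolding steers_def state_space_def mem_Collect_eq by blast
qed

lemma flows_concatenate:
  fixes y :: "nat \<Rightarrow> real \<times> real" and d v :: "nat \<Rightarrow> real"
  assumes "fst (y 0) > 0" and "m > 0"
    and "\<And>i. i < m \<Longrightarrow> d i > 0 \<and> v i \<noteq> 0 \<and> - u1 \<le> v i \<and> v i \<le> u2 \<and> flow (v i) (d i) (y i) = y (Suc i)"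
    and "\<tau> = (\<lambda>i. \<Sum>j<i. d j)"
  shows "\<exists>u x. steers u1 u2 (\<tau> m) u x (y 0) (y m) \<and> 
     (\<forall>i<m. (\<forall>t\<in>{\<tau> i<..<\<tau> (Suc i)}. u t = v i) \<and>
       (\<forall>t\<in>{\<tau> i..\<tau> (Suc i)}. x t = flow (v i) (t - \<tau> i) (y i)))"
  using assms(2,3)
proof (induction m)
  case 0
  then show ?case by simp
next
  case (Suc m)
  have v: "d m > 0" "v m \<noteq> 0" "- u1 \<le> v m" "v m \<le> u2" "flow (v m) (d m) (y m) = y (Suc m)"
    using Suc.prems(2)[of m] by auto
  have "\<exists>u x. steers u1 u2 (\<tau> m) u x (y 0) (y m) \<and> 
     (\<forall>i<m. (\<forall>t\<in>{\<tau> i<..<\<tau> (Suc i)}. u t = v i) \<and>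
       (\<forall>t\<in>{\<tau> i..\<tau> (Suc i)}. x t = flow (v i) (t - \<tau> i) (y i)))"
  proof (cases "m = 0")
    case True
    then show ?thesis using steers_refl[OF assms(1) v(3,4)] by (auto simp: assms(4))
  next
    case False
    then show ?thesis using Suc by auto
  qed
  then obtain u x where st: "steers u1 u2 (\<tau> m) u x (y 0) (y m)" 
    and u: "\<And>i t. i < m \<Longrightarrow> t \<in> {\<tau> i<..<\<tau> (Suc i)} \<Longrightarrow> u t = v i"
    and x: "\<And>i t. i < m \<Longrightarrow> t \<in> {\<tau> i..\<tau> (Suc i)} \<Longrightarrow> x t = flow (v i) (t - \<tau> i) (y i)"
    by blast
  have \<tau>S: "\<tau> (Suc m) = \<tau> m + d m" by (simp add: assms(4))
  have le: "\<tau> (Suc i) \<le> \<tau> m" if "i < m" for i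
    unfolding assms(4) using that Suc.prems(2) by (intro sum_mono2) (auto intro!: less_imp_le)
  have xm: "x (\<tau> m) = y m" and "0 \<le> \<tau> m" using st by (auto simp: steers_def)
  then have ym: "fst (y m) > 0" using steers_pos[OF st, of "\<tau> m"] by simp
  define u' where "u' = (\<lambda>t. if t \<le> \<tau> m then u t else v m)"
  define x' where "x' = (\<lambda>t. if t \<le> \<tau> m then x t else flow (v m) (t - \<tau> m) (y m))"
  have "steers u1 u2 (\<tau> (Suc m)) u' x' (y 0) (y (Suc m))"
    using steers_append_flow[OF st less_imp_le[OF v(1)] v(2-4)] v(5)
    by (simp add: \<tau>S u'_def x'_def)
  moreover have "u' t = v i" if "i < Suc m" "t \<in> {\<tau> i<..<\<tau> (Suc i)}" for i t
    using that u[of i t] le[of i] by (cases "i = m") (auto simp: u'_def)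
  moreover have "x' t = flow (v i) (t - \<tau> i) (y i)" if "i < Suc m" "t \<in> {\<tau> i..\<tau> (Suc i)}" for i t
    using that x[of i t] le[of i] xm flow_0[OF ym] by (cases "i = m") (auto simp: x'_def)
  ultimately show ?case by blast
qed

lemma bang_bang_exists:
  fixes y :: "nat \<Rightarrow> real \<times> real" and d v :: "nat \<Rightarrow> real"
  assumes y: "y 0 = (1, 0)" "y (Suc m) = (\<gamma>, 0)" 
    and d: "\<And>i. i \<le> m \<Longrightarrow> d i > 0" 
    and v: "\<And>i. i \<le> m \<Longrightarrow> v i \<noteq> 0 \<and> - u1 \<le> v i \<and> v i \<le> u2"
    and flow: "\<And>i. i \<le> m \<Longrightarrow> flow (v i) (d i) (y i) = y (Suc i)"
    and inj: "\<And>i. i \<le> m \<Longrightarrow> inj_on (\<lambda>t. flow (v i) t (y i)) {0..d i}"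
    and ypos: "\<And>i. i \<le> m \<Longrightarrow> fst (y i) > 0"
  shows "\<exists>\<tau> u x. bang_bang u1 u2 \<gamma> m v \<tau> u x \<and> (\<forall>i\<le>m. x (\<tau> i) = y i)"
proof -
  define \<tau> where "\<tau> = (\<lambda>i. \<Sum>j<i. d j)"
  have "\<exists>u x. steers u1 u2 (\<tau> (Suc m)) u x (y 0) (y (Suc m)) \<and> 
     (\<forall>i<Suc m. (\<forall>t\<in>{\<tau> i<..<\<tau> (Suc i)}. u t = v i) \<and>
       (\<forall>t\<in>{\<tau> i..\<tau> (Suc i)}. x t = flow (v i) (t - \<tau> i) (y i)))"
    using assms by (intro flows_concatenate[where d=d]) (auto simp: \<tau>_def less_Suc_eq_le)
  then obtain u x where st: "steers u1 u2 (\<tau> (Suc m)) u x (1, 0) (\<gamma>, 0)" 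
    and u: "\<And>i t. i \<le> m \<Longrightarrow> t \<in> {\<tau> i<..<\<tau> (Suc i)} \<Longrightarrow> u t = v i"
    and x: "\<And>i t. i \<le> m \<Longrightarrow> t \<in> {\<tau> i..\<tau> (Suc i)} \<Longrightarrow> x t = flow (v i) (t - \<tau> i) (y i)"
    unfolding y less_Suc_eq_le by blast
  have \<tau>S: "\<tau> (Suc i) = \<tau> i + d i" for i by (simp add: \<tau>_def)
  have "inj_on x {\<tau> i..\<tau> (Suc i)}" if "i \<le> m" for i
  proof (rule inj_onI)
    fix s t assume st: "s \<in> {\<tau> i..\<tau> (Suc i)}" "t \<in> {\<tau> i..\<tau> (Suc i)}" "x s = x t"
    then have "s - \<tau> i = t - \<tau> i"
      using x[OF that] by (intro inj_onD[OF inj[OF that]]) (auto simp: \<tau>S)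
    then show "s = t" by simp
  qed
  moreover have "x (\<tau> i) = y i" if "i \<le> m" for i
    using x[OF that, of "\<tau> i"] d[OF that] ypos[OF that] by (simp add: \<tau>S flow_0)
  ultimately have "bang_bang u1 u2 \<gamma> m v \<tau> u x \<and> (\<forall>i\<le>m. x (\<tau> i) = y i)"
    using st u d by (auto simp: bang_bang_def \<tau>S \<tau>_def)
  then show ?thesis by blast
qed

text \<open>In the integrated form, continuity of the state is a consequence of the equation.\<close>
lemma steers_continuous:
  assumes "steers u1 u2 T u x p q"
  shows "continuous_on {0..T} x"
proof -
  have *: "((\<lambda>r. dynamics (u r) (x r)) has_integral (x t - x 0)) {0..t}" if "t \<in> {0..T}" for t
    using assms that by (auto simp: steers_def)
  then have "(\<lambda>r. dynamics (u r) (x r)) integrable_on {0..T}"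
    using assms has_integral_integrable[OF *, of T] by (simp add: steers_def)
  then have "continuous_on {0..T} (\<lambda>t. x 0 + integral {0..t} (\<lambda>r. dynamics (u r) (x r)))"
    by (intro continuous_intros indefinite_integral_continuous_1)
  then show ?thesis
    by (rule continuous_on_eq) (simp add: integral_unique[OF *])
qed

text \<open>On an interval of constant control the integrand is continuous, because the state is. So the
  integrated equation can be differentiated there, and uniqueness of solutions applies.\<close>
lemma steers_flow:
  assumes st: "steers u1 u2 T u x p q" and "0 \<le> b" "c \<le> T" "a \<noteq> 0"
    and u: "\<And>t. t \<in> {b<..<c} \<Longrightarrow> u t = a" and t: "t \<in> {b..c}"
  shows "x t = flow a (t - b) (x b)"
proof (rule solution_is_flow[OF assms(4) _ _ t])
  note pos = steers_pos[OF st]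
  show "fst (x t) > 0" if "t \<in> {b..c}" for t
    using pos that assms by auto
  have int: "((\<lambda>r. dynamics (u r) (x r)) has_integral (x t - x 0)) {0..t}" if "t \<in> {0..T}" for t
    using st that by (auto simp: steers_def)
  have cont: "continuous_on {b..c} (\<lambda>r. dynamics a (x r))"
  proof -
    have "continuous_on {b..c} x"
      using steers_continuous[OF st] by (rule continuous_on_subset) (use assms in auto)
    moreover have "fst (x t) \<noteq> 0" if "t \<in> {b..c}" for t
      using pos[of t] that assms by auto
    ultimately show ?thesis unfolding dynamics_def
      by (auto intro!: continuous_intros)
  qed
  have eq: "x s = x b + integral {b..s} (\<lambda>r. dynamics a (x r))" if s: "s \<in> {b..c}" for s
  proof -
    let ?f = "\<lambda>r. dynamics (u r) (x r)"
    have "?f integrable_on {0..s}" using int[of s] s assms by (auto simp: integrable_on_def)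
    then have "integral {0..b} ?f + integral {b..s} ?f = integral {0..s} ?f"
      using s assms by (intro Henstock_Kurzweil_Integration.integral_combine) auto
    then have "x s = x b + integral {b..s} ?f"
      using int[of s] int[of b] s assms by (simp add: integral_unique algebra_simps)
    also have "integral {b..s} ?f = integral {b..s} (\<lambda>r. dynamics a (x r))"
      using s u by (intro integral_spike[of "{b, s}"]) auto
    finally show ?thesis .
  qed
  show "(x has_vector_derivative dynamics a (x s)) (at s within {b..c})" if s: "s \<in> {b..c}" for s
  proof -
    have "((\<lambda>s. x b + integral {b..s} (\<lambda>r. dynamics a (x r))) has_vector_derivative dynamics a (x s))
        (at s within {b..c})"
      using has_vector_derivative_add[OF has_vector_derivative_const integral_has_vector_derivative[OF cont s]]
      by simp
    from has_vector_derivative_transform[OF s _ this] eq show ?thesis by blast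
  qed
qed

lemma bang_bang_times:
  assumes "bang_bang u1 u2 \<gamma> m v \<tau> u x" "i \<le> j" "j \<le> Suc m"
  shows "\<tau> i \<le> \<tau> j"
  using assms(2,3)
proof (induction j rule: dec_induct)
  case (step k)
  then show ?case using assms(1) by (fastforce simp: bang_bang_def)
qed simp

lemma bang_bang_flow:
  assumes bb: "bang_bang u1 u2 \<gamma> m v \<tau> u x" and "i \<le> m" "v i \<noteq> 0" "t \<in> {\<tau> i..\<tau> (Suc i)}"
  shows "x t = flow (v i) (t - \<tau> i) (x (\<tau> i))"
proof (rule steers_flow[where c = "\<tau> (Suc i)" and u = u])
  show "steers u1 u2 (\<tau> (Suc m)) u x (1, 0) (\<gamma>, 0)" using bb by (simp add: bang_bang_def)
  show "0 \<le> \<tau> i" using bang_bang_times[OF bb, of 0 i] bb assms by (simp add: bang_bang_def)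
  show "\<tau> (Suc i) \<le> \<tau> (Suc m)" using bang_bang_times[OF bb, of "Suc i" "Suc m"] assms by simp
qed (use assms in \<open>auto simp: bang_bang_def\<close>)

lemma bang_bang_pos:
  assumes bb: "bang_bang u1 u2 \<gamma> m v \<tau> u x" and "i \<le> Suc m"
  shows "fst (x (\<tau> i)) > 0"
proof (rule steers_pos)
  show "steers u1 u2 (\<tau> (Suc m)) u x (1, 0) (\<gamma>, 0)" using bb by (simp add: bang_bang_def)
  show "\<tau> i \<in> {0..\<tau> (Suc m)}"
    using bang_bang_times[OF bb, of 0 i] bang_bang_times[OF bb, of i "Suc m"] bb assms(2)
    by (simp add: bang_bang_def)
qed

section \<open>Times between two states of an orbit\<close>
text \<open>For \<open>a > 0\<close> this is the squared radius of the circle on which \<open>(offset, momentum / sqrt a)\<close> moves.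
  It depends on the first integral only (\<open>offset_norm\<close>), and it vanishes exactly at an equilibrium.\<close>
definition amplitude :: "real \<Rightarrow> real \<times> real \<Rightarrow> real" where
  "amplitude a p = (offset a p)\<^sup>2 + (momentum p)\<^sup>2 / a"

lemma amplitude_cong:
  assumes "fst p > 0" "fst p' > 0" "a \<noteq> 0" "Y_first_integral a p = Y_first_integral a p'"
  shows "amplitude a p = amplitude a p'"
  using assms by (simp add: amplitude_def offset_norm)

lemma flow_eq_iff_offset:
  assumes "fst p > 0" "fst p' > 0" "a \<noteq> 0" "Y_first_integral a p = Y_first_integral a p'"
  shows "flow a t p = p' \<longleftrightarrow>
    offset a p * gcos a t + momentum p * gsin a t = offset a p' \<and>
    momentum p * gcos a t - a * offset a p * gsin a t = momentum p'"
  using assms by (auto simp: flow_eq_iff sqflow_def momflow_def offset_def)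

text \<open>Solving the rotation equations for the rotation: unless the state is an equilibrium, the
  cosine and sine of the angle between two states of an orbit are determined by the states.\<close>
lemma flow_eq_iff_angle:
  assumes "fst p > 0" "fst p' > 0" "a \<noteq> 0" "Y_first_integral a p = Y_first_integral a p'"
    and N: "amplitude a p \<noteq> 0"
  shows "flow a t p = p' \<longleftrightarrow>
    gcos a t = (offset a p * offset a p' + momentum p * momentum p' / a) / amplitude a p \<and>
    gsin a t = (momentum p * offset a p' - offset a p * momentum p') / (a * amplitude a p)"
    (is "_ \<longleftrightarrow> ?r")
proof -
  define A where "A = offset a p"
  define m where "m = momentum p"
  define A' where "A' = offset a p'"
  define m' where "m' = momentum p'"
  define C where "C = gcos a t"
  define S where "S = gsin a t"
  define M where "M = amplitude a p"
  have M: "M = A\<^sup>2 + m\<^sup>2 / a" by (simp add: M_def amplitude_def A_def m_def)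
  have "M \<noteq> 0" using N by (simp add: M_def)
  have "A * C + m * S = A' \<and> m * C - a * A * S = m' \<longleftrightarrow>
     C = (A * A' + m * m' / a) / M \<and> S = (m * A' - A * m') / (a * M)" (is "?l \<longleftrightarrow> ?r'")
  proof
    assume ?l
    then have l: "A' = A * C + m * S" "m' = m * C - a * A * S" by auto
    have "A * A' + m * m' / a = C * M" "m * A' - A * m' = S * (a * M)"
      unfolding l M using assms(3) by (simp_all add: field_simps power2_eq_square)
    then show ?r' using \<open>M \<noteq> 0\<close> assms(3) by simp
  next
    assume ?r'
    then have CM: "C * M = A * A' + m * m' / a" and SM: "S * M = (m * A' - A * m') / a"
      using \<open>M \<noteq> 0\<close> assms(3) by simp_all
    have "(A * C + m * S) * M = A * (C * M) + m * (S * M)"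
      "(m * C - a * A * S) * M = m * (C * M) - a * A * (S * M)"
      by (simp_all add: algebra_simps)
    then have "(A * C + m * S) * M = A * (A * A' + m * m' / a) + m * ((m * A' - A * m') / a)"
      "(m * C - a * A * S) * M = m * (A * A' + m * m' / a) - a * A * ((m * A' - A * m') / a)"
      unfolding CM SM by simp_all
    moreover have "A * (A * A' + m * m' / a) + m * ((m * A' - A * m') / a) = A' * M"
      "m * (A * A' + m * m' / a) - a * A * ((m * A' - A * m') / a) = m' * M"
      unfolding M using assms(3) by (simp_all add: field_simps power2_eq_square)
    ultimately have "(A * C + m * S) * M = A' * M" "(m * C - a * A * S) * M = m' * M" by simp_all
    then show ?l using \<open>M \<noteq> 0\<close> by simp
  qed
  then show ?thesis
    unfolding flow_eq_iff_offset[OF assms(1-4)] A_def m_def A'_def m'_def C_def S_def M_def .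
qed

lemma flow_cong:
  assumes "gcos a t = gcos a t'" "gsin a t = gsin a t'"
  shows "flow a t p = flow a t' p"
  using assms by (simp add: flow_def sqflow_def momflow_def)

lemma flow_period:
  assumes "a > 0" "fst p > 0" shows "flow a (pi / sqrt a) p = p"
proof -
  have "flow a (pi / sqrt a) p = flow a 0 p"
    using assms by (intro flow_cong) (simp_all add: gcos_def gsin_def)
  then show ?thesis using assms by (simp add: flow_0)
qed

lemma amplitude_pos_neg: "fst p > 0 \<Longrightarrow> a < 0 \<Longrightarrow> amplitude a p > 0"
  by (simp add: amplitude_def offset_norm diff_conv_add_uminus add_nonneg_pos del: add_uminus_conv_diff)

text \<open>An orbit of vanishing amplitude is an equilibrium, so it does not contain two states.\<close>
lemma amplitude_pos_distinct:
  assumes "fst p > 0" "fst p' > 0" "a > 0" "Y_first_integral a p = Y_first_integral a p'" "p \<noteq> p'"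
  shows "amplitude a p > 0"
proof (rule ccontr)
  assume "\<not> ?thesis"
  moreover have nonneg: "amplitude a p \<ge> 0" using assms(3) by (simp add: amplitude_def)
  ultimately have 0: "amplitude a p = 0" "amplitude a p' = 0"
    using amplitude_cong[of p p' a] assms by auto
  have "x = 0 \<and> y = 0" if "x\<^sup>2 + y\<^sup>2 / a = 0" for x y :: real
    using that assms(3) add_nonneg_eq_0_iff[of "x\<^sup>2" "y\<^sup>2 / a"] by simp
  from this[OF 0(1)[unfolded amplitude_def]] this[OF 0(2)[unfolded amplitude_def]]
  have "flow a 0 p = p'"
    using assms by (simp add: flow_eq_iff_offset)
  then show False using assms by (simp add: flow_0)
qed

text \<open>The bound \<open>pi / sqrt a\<close> is the period of the \<open>Y\<close>-flow; the \<open>X\<close>-flow has none.\<close>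
lemma angle_injective:
  assumes "a \<noteq> 0" "t \<in> {0..d}" "t' \<in> {0..d}" "a > 0 \<Longrightarrow> d < pi / sqrt a"
    and "gcos a t = gcos a t'" "gsin a t = gsin a t'"
  shows "t = t'"
proof (cases "a > 0")
  case True
  then have sa: "sqrt a > 0" by simp
  have "cos (2 * sqrt a * t) = cos (2 * sqrt a * t')" "sin (2 * sqrt a * t) = sin (2 * sqrt a * t')"
    using assms True by (simp_all add: gcos_def gsin_def)
  then obtain n :: int where n: "2 * sqrt a * t = 2 * sqrt a * t' + 2 * pi * n"
    using sin_cos_eq_iff by metis
  then have eq: "sqrt a * (t - t') = pi * n" by (simp add: algebra_simps)
  have "\<bar>t - t'\<bar> \<le> d" using assms(2,3) by auto
  then have "\<bar>t - t'\<bar> < pi / sqrt a" using assms(4)[OF True] by linarith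
  then have "sqrt a * \<bar>t - t'\<bar> < pi" using sa by (simp add: pos_less_divide_eq mult.commute)
  then have "pi * \<bar>real_of_int n\<bar> < pi * 1"
    using eq sa by (metis abs_mult abs_of_pos mult.right_neutral pi_gt_zero)
  then have "\<bar>n\<bar> < 1" by simp
  then have "n = 0" by simp
  then show ?thesis using eq sa by simp
next
  case False
  then have "sqrt (- a) > 0" using assms(1) by simp
  then show ?thesis using assms False by (simp add: gsin_def)
qed

lemma flow_inj_on:
  assumes "a \<noteq> 0" "fst p > 0" "amplitude a p \<noteq> 0" "a > 0 \<Longrightarrow> d < pi / sqrt a"
  shows "inj_on (\<lambda>t. flow a t p) {0..d}"
proof (rule inj_onI)
  fix t t' assume t: "t \<in> {0..d}" "t' \<in> {0..d}" and eq: "flow a t p = flow a t' p"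
  have "gcos a t = gcos a t' \<and> gsin a t = gsin a t'"
  proof -
    have *: "fst (flow a t' p) > 0" "Y_first_integral a p = Y_first_integral a (flow a t' p)"
      using assms by (auto simp: fst_flow_pos first_integral_flow)
    note iff = flow_eq_iff_angle[OF assms(2) *(1) assms(1) *(2) assms(3)]
    from iff[of t] iff[of t'] eq show ?thesis by metis
  qed
  then show "t = t'" using angle_injective t assms by blast
qed

text \<open>The prospective cosine and sine of the angle between two states satisfy the (hyperbolic)
  Pythagorean identity, by the identity of Brahmagupta. Hence such an angle exists.\<close>
lemma angle_addition_identity:
  assumes "fst p > 0" "fst p' > 0" "a \<noteq> 0" "Y_first_integral a p = Y_first_integral a p'"
    and N: "amplitude a p \<noteq> 0"
  shows "((offset a p * offset a p' + momentum p * momentum p' / a) / amplitude a p)\<^sup>2 +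
    a * ((momentum p * offset a p' - offset a p * momentum p') / (a * amplitude a p))\<^sup>2 = 1"
proof -
  have "(offset a p * offset a p' + momentum p * momentum p' / a)\<^sup>2 +
      a * ((momentum p * offset a p' - offset a p * momentum p') / a)\<^sup>2
      = amplitude a p * amplitude a p'"
    unfolding amplitude_def using assms(3) by (simp add: field_simps power2_eq_square)
  also have "amplitude a p' = amplitude a p" using amplitude_cong assms by metis
  finally have "(offset a p * offset a p' + momentum p * momentum p' / a)\<^sup>2 +
      a * ((momentum p * offset a p' - offset a p * momentum p') / a)\<^sup>2 = (amplitude a p)\<^sup>2"
    by (simp add: power2_eq_square)
  then have "((offset a p * offset a p' + momentum p * momentum p' / a)\<^sup>2 +
      a * ((momentum p * offset a p' - offset a p * momentum p') / a)\<^sup>2) / (amplitude a p)\<^sup>2 = 1"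
    using N by simp
  then show ?thesis unfolding add_divide_distrib[of _ _ "(amplitude a p)\<^sup>2"]
    by (simp add: power_divide power_mult_distrib)
qed

text \<open>An orbit of the control \<open>a > 0\<close> is one closed curve, run through periodically.\<close>
lemma Y_reachable:
  assumes "fst p > 0" "fst p' > 0" "a > 0" "Y_first_integral a p = Y_first_integral a p'" "p \<noteq> p'"
  shows "\<exists>t. 0 < t \<and> flow a t p = p' \<and> inj_on (\<lambda>t. flow a t p) {0..t}"
proof -
  have a: "a \<noteq> 0" and sa: "sqrt a > 0" using assms(3) by auto
  have N: "amplitude a p \<noteq> 0" using amplitude_pos_distinct[OF assms] by simp
  have circle: "((offset a p * offset a p' + momentum p * momentum p' / a) / amplitude a p)\<^sup>2 +
      (sqrt a * ((momentum p * offset a p' - offset a p * momentum p') / (a * amplitude a p)))\<^sup>2 = 1"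
    using angle_addition_identity[OF assms(1,2) a assms(4) N] assms(3)
    by (simp only: power_mult_distrib real_sqrt_pow2 less_imp_le)
  obtain \<theta> where \<theta>: "0 \<le> \<theta>" "\<theta> < 2 * pi"
    "(offset a p * offset a p' + momentum p * momentum p' / a) / amplitude a p = cos \<theta>"
    "sqrt a * ((momentum p * offset a p' - offset a p * momentum p') / (a * amplitude a p)) = sin \<theta>"
    by (rule sincos_total_2pi[OF circle])
  define t where "t = \<theta> / (2 * sqrt a)"
  have "2 * sqrt a * t = \<theta>" using sa by (simp add: t_def)
  then have "gcos a t = cos \<theta>" "gsin a t = sin \<theta> / sqrt a"
    using assms(3) by (simp_all add: gcos_def gsin_def)
  then have fl: "flow a t p = p'"
    unfolding flow_eq_iff_angle[OF assms(1,2) a assms(4) N] \<theta>(3)[symmetric] \<theta>(4)[symmetric]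
    using sa by simp
  moreover from this have "t \<noteq> 0" using assms flow_0 by metis
  moreover have "t \<ge> 0" using \<theta> sa by (simp add: t_def)
  moreover have "t < pi / sqrt a"
    using divide_strict_right_mono[OF \<theta>(2), of "2 * sqrt a"] sa by (simp add: t_def)
  then have "inj_on (\<lambda>t. flow a t p) {0..t}" by (rule flow_inj_on[OF a assms(1) N])
  ultimately show ?thesis by (intro exI[of _ t]) simp
qed

lemma offset_pos_neg:
  assumes "fst p > 0" "a < 0" shows "offset a p > 0"
proof -
  have "(snd p)\<^sup>2 + 1 / (fst p)\<^sup>2 > 0" using assms(1) by (simp add: add_nonneg_pos)
  then have "((snd p)\<^sup>2 + 1 / (fst p)\<^sup>2) / (2 * a) < 0" using assms(2) by (intro divide_pos_neg) auto
  moreover have "offset a p = (fst p)\<^sup>2 / 2 - ((snd p)\<^sup>2 + 1 / (fst p)\<^sup>2) / (2 * a)"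
    using assms(2) by (simp add: offset_def Y_first_integral_def add_divide_distrib)
  ultimately show ?thesis using zero_le_power2[of "fst p"] by linarith
qed

text \<open>For \<open>a < 0\<close> every orbit is a single curve along which \<open>x2\<close> increases; only forward times are
  admitted, which is what the signs of \<open>x2\<close> ensure.\<close>
lemma X_reachable:
  assumes "fst p > 0" "fst p' > 0" "a < 0" "Y_first_integral a p = Y_first_integral a p'"
    and "snd p \<le> 0" "snd p' > 0"
  shows "\<exists>t. 0 < t \<and> flow a t p = p' \<and> inj_on (\<lambda>t. flow a t p) {0..t}"
proof -
  have a: "a \<noteq> 0" and sa: "sqrt (- a) > 0" using assms(3) by auto
  have N: "amplitude a p > 0" using amplitude_pos_neg assms by blast
  then have N0: "amplitude a p \<noteq> 0" by simp
  have off: "offset a p > 0" "offset a p' > 0" using offset_pos_neg assms by auto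
  have m: "momentum p \<le> 0" "momentum p' > 0"
    using assms by (auto simp: momentum_def mult_le_0_iff)
  define C where "C = (offset a p * offset a p' + momentum p * momentum p' / a) / amplitude a p"
  define S where "S = (momentum p * offset a p' - offset a p * momentum p') / (a * amplitude a p)"
  have "momentum p * momentum p' / a \<ge> 0" using m assms(3) by (simp add: divide_nonpos_neg mult_nonpos_nonneg)
  then have C: "C > 0" unfolding C_def using off N by (intro divide_pos_pos add_pos_nonneg) auto
  have "momentum p * offset a p' \<le> 0" "offset a p * momentum p' > 0"
    using off m by (auto simp: mult_nonpos_nonneg)
  then have S: "S > 0" unfolding S_def
    using N assms(3) by (intro divide_neg_neg) (auto simp: mult_neg_pos)
  have CS: "C\<^sup>2 + a * S\<^sup>2 = 1"
    unfolding C_def S_def by (rule angle_addition_identity[OF assms(1,2) a assms(4) N0])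
  define t where "t = arsinh (sqrt (- a) * S) / (2 * sqrt (- a))"
  have t2: "2 * sqrt (- a) * t = arsinh (sqrt (- a) * S)" using sa by (simp add: t_def)
  have "gsin a t = S" using t2 assms(3) sa by (simp add: gsin_def sinh_arsinh_real)
  moreover have "gcos a t = C"
  proof -
    have "(gcos a t)\<^sup>2 = C\<^sup>2" using gcos_gsin_identity[OF a, of t] CS \<open>gsin a t = S\<close> by simp
    moreover have "gcos a t > 0" using assms(3) by (simp add: gcos_def cosh_real_pos)
    ultimately show ?thesis using C by (simp add: power2_eq_iff_nonneg)
  qed
  ultimately have "flow a t p = p'"
    unfolding flow_eq_iff_angle[OF assms(1,2) a assms(4) N0] C_def S_def by simp
  moreover have "t > 0" unfolding t_def using sa S by simp
  moreover have "inj_on (\<lambda>t. flow a t p) {0..t}"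
    using assms(3) by (intro flow_inj_on[OF a assms(1) N0]) simp
  ultimately show ?thesis by blast
qed

lemma time_from_gcos_neg:
  assumes "a < 0" "t \<ge> 0" 
  shows "t = arcosh (gcos a t) / (2 * sqrt (- a))"
  using assms by (simp add: gcos_def arcosh_cosh_real)

text \<open>Within one period the cosine of the angle leaves two candidates for the time, between which
  the sign of the sine decides.\<close>
lemma time_from_gcos_pos:
  assumes "a > 0" "0 < t" "t < pi / sqrt a"
  shows "gsin a t > 0 \<Longrightarrow> t = arccos (gcos a t) / (2 * sqrt a)"
    and "gsin a t < 0 \<Longrightarrow> t = (2 * pi - arccos (gcos a t)) / (2 * sqrt a)"
proof -
  define \<theta> where "\<theta> = 2 * sqrt a * t"
  have sa: "sqrt a > 0" using assms by simp
  have t: "t = \<theta> / (2 * sqrt a)" using sa by (simp add: \<theta>_def)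
  have \<theta>: "0 < \<theta>" "\<theta> < 2 * pi" using assms sa by (auto simp: \<theta>_def field_simps)
  have g: "gsin a t = sin \<theta> / sqrt a" "gcos a t = cos \<theta>" using assms by (auto simp: gsin_def gcos_def \<theta>_def)
  show "t = arccos (gcos a t) / (2 * sqrt a)" if "gsin a t > 0"
  proof -
    have "sin \<theta> > 0" using that g sa by (simp add: zero_less_divide_iff)
    then have "\<theta> < pi" using \<theta> sin_le_zero[of \<theta>] by fastforce
    then show ?thesis using \<theta> g t by (simp add: arccos_cos)
  qed
  show "t = (2 * pi - arccos (gcos a t)) / (2 * sqrt a)" if "gsin a t < 0"
  proof -
    have "sin \<theta> < 0" using that g sa by (simp add: divide_less_0_iff)
    then have "\<theta> > pi" using \<theta> sin_ge_zero[of \<theta>] by fastforce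
    moreover have "cos \<theta> = cos (2 * pi - \<theta>)" by simp
    ultimately have "arccos (cos \<theta>) = 2 * pi - \<theta>" using \<theta> arccos_cos[of "2 * pi - \<theta>"] by simp
    then show ?thesis using g t by simp
  qed
qed

lemma flow_to_rest:
  assumes "fst p > 0" "r > 0" "a \<noteq> 0" "offset a (r, 0) \<noteq> 0" "flow a t p = (r, 0)"
  shows "gcos a t = offset a p / offset a (r, 0)" "gsin a t = momentum p / (a * offset a (r, 0))"
proof -
  have E: "Y_first_integral a p = Y_first_integral a (r, 0)"
    using first_integral_flow[OF assms(1,3), of t] assms(5) by simp
  have r: "fst (r, 0 :: real) > 0" using assms(2) by simp
  have N: "amplitude a p = (offset a (r, 0))\<^sup>2"
    using amplitude_cong[OF assms(1) r assms(3) E] by (simp add: amplitude_def momentum_def)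
  then have N0: "amplitude a p \<noteq> 0" using assms(4) by simp
  note angle = flow_eq_iff_angle[OF assms(1) r assms(3) E N0, THEN iffD1, OF assms(5)]
  show "gcos a t = offset a p / offset a (r, 0)" "gsin a t = momentum p / (a * offset a (r, 0))"
    using angle assms(3,4) by (simp_all add: N power2_eq_square momentum_def)
qed

lemma flow_from_rest:
  assumes "r > 0" "a \<noteq> 0" 
  shows "offset a (flow a t (r, 0)) = offset a (r, 0) * gcos a t"
    "momentum (flow a t (r, 0)) = - a * offset a (r, 0) * gsin a t"
proof -
  have r: "fst (r, 0 :: real) > 0" using assms(1) by simp
  show "offset a (flow a t (r, 0)) = offset a (r, 0) * gcos a t"
    "momentum (flow a t (r, 0)) = - a * offset a (r, 0) * gsin a t"
    using flow_eq_iff_offset[OF r fst_flow_pos[OF r assms(2)] assms(2)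
        first_integral_flow[OF r assms(2), symmetric], THEN iffD1, OF refl]
    by (simp_all add: momentum_def)
qed

text \<open>The upper bound on the duration expresses that a \<open>Y\<close>-segment without repeated states cannot
  complete a revolution of its closed orbit.\<close>
lemma bang_bang_segment:
  assumes bb: "bang_bang u1 u2 \<gamma> m v \<tau> u x" and i: "i \<le> m" and v: "v i \<noteq> 0"
  shows "flow (v i) (\<tau> (Suc i) - \<tau> i) (x (\<tau> i)) = x (\<tau> (Suc i))"
    "\<tau> (Suc i) - \<tau> i > 0"
    "v i > 0 \<Longrightarrow> \<tau> (Suc i) - \<tau> i < pi / sqrt (v i)"
proof -
  have lt: "\<tau> i < \<tau> (Suc i)" using bb i by (simp add: bang_bang_def)
  then show "\<tau> (Suc i) - \<tau> i > 0" by simp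
  show "flow (v i) (\<tau> (Suc i) - \<tau> i) (x (\<tau> i)) = x (\<tau> (Suc i))"
    using bang_bang_flow[OF bb i v, of "\<tau> (Suc i)"] lt by simp
  show "\<tau> (Suc i) - \<tau> i < pi / sqrt (v i)" if "v i > 0"
  proof (rule ccontr)
    assume n: "\<not> ?thesis"
    define t where "t = \<tau> i + pi / sqrt (v i)"
    have pos: "pi / sqrt (v i) > 0" using that by simp
    have t: "t \<in> {\<tau> i..\<tau> (Suc i)}" using n pos by (simp add: t_def)
    have "x t = x (\<tau> i)"
      using bang_bang_flow[OF bb i v t] flow_period[OF that bang_bang_pos[OF bb, of i]] i
      by (simp add: t_def)
    moreover have "inj_on x {\<tau> i..\<tau> (Suc i)}" using bb i by (simp add: bang_bang_def)
    ultimately have "t = \<tau> i" using t lt by (auto dest: inj_onD)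
    then show False using pos by (simp add: t_def)
  qed
qed

section \<open>One switching\<close>

text \<open>The formula for one switching is stated in half angles: \<open>(gcos a t - 1) / 2\<close> is a squared
  hyperbolic sine, and along an orbit that starts with \<open>x2 = 0\<close> it is proportional to the increase
  of \<open>x1\<^sup>2\<close>.\<close>
lemma half_angle_time_neg:
  assumes "a < 0" "t \<ge> 0"
  shows "t = arsinh (sqrt ((gcos a t - 1) / 2)) / sqrt (- a)"
proof -
  have sa: "sqrt (- a) > 0" using assms by simp
  have "(gcos a t - 1) / 2 = (sinh (sqrt (- a) * t))\<^sup>2"
    using assms cosh_double[of "sqrt (- a) * t"] cosh_square_eq[of "sqrt (- a) * t"]
    by (simp add: gcos_def mult.assoc)
  then show ?thesis using assms sa by (simp add: arsinh_sinh_real)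
qed

lemma half_angle_time_pos:
  assumes "a > 0" "0 < t" "t < pi / sqrt a" "gsin a t > 0"
  shows "t = arcsin (sqrt ((1 - gcos a t) / 2)) / sqrt a"
proof -
  have sa: "sqrt a > 0" using assms by simp
  define \<theta> where "\<theta> = sqrt a * t"
  have \<theta>: "0 < \<theta>" "\<theta> < pi" using assms sa by (auto simp: \<theta>_def field_simps)
  have "sin (2 * \<theta>) > 0" using assms sa by (simp add: gsin_def \<theta>_def zero_less_divide_iff mult.assoc)
  then have "2 * \<theta> < pi" using \<theta> sin_le_zero[of "2 * \<theta>"] by fastforce
  moreover have "(1 - gcos a t) / 2 = (sin \<theta>)\<^sup>2"
    using assms cos_double_sin[of \<theta>] by (simp add: gcos_def \<theta>_def mult.assoc)
  moreover have "sin \<theta> \<ge> 0" using \<theta> by (simp add: sin_ge_zero)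
  ultimately have "arcsin (sqrt ((1 - gcos a t) / 2)) = \<theta>"
    using \<theta> by (simp add: arcsin_sin)
  then show ?thesis using sa by (simp add: \<theta>_def)
qed

lemma first_integral_start: "Y_first_integral u2 (1, 0) = c_first u2"
  and first_integral_target: "Y_first_integral u2 (\<gamma>, 0) = c_last u2 \<gamma>"
  by (simp_all add: Y_first_integral_def c_first_def c_last_def)

lemma offset_start: "a \<noteq> 0 \<Longrightarrow> offset a (1, 0) = (a - 1) / (2 * a)"
  by (simp add: offset_def Y_first_integral_def field_simps)

lemma offset_target:
  assumes "u2 > 0" "\<gamma> > 0"
  shows "2 * offset u2 (\<gamma>, 0) = (u2 * \<gamma>^4 - 1) / (u2 * \<gamma>\<^sup>2)"
  using assms by (simp add: offset_def Y_first_integral_def field_simps power4_eq_xxxx power2_eq_square)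

lemma offset_target_pos:
  assumes "u2 \<ge> 1" "\<gamma> > 1" shows "offset u2 (\<gamma>, 0) > 0"
proof -
  have "1 < \<gamma>^4" using assms by (simp add: one_less_power)
  also have "\<dots> \<le> u2 * \<gamma>^4" using assms by simp
  finally have "2 * offset u2 (\<gamma>, 0) > 0" using assms offset_target[of u2 \<gamma>] by simp
  then show ?thesis by simp
qed

text \<open>The square of \<open>x1\<close> at the switching point: subtracting the first integrals of the \<open>X\<close>-orbit
  through \<open>(1, 0)\<close> and the \<open>Y\<close>-orbit through \<open>(\<gamma>, 0)\<close> leaves \<open>(u1 + u2) * x1\<^sup>2 = c_last u2 \<gamma> - (1 - u1)\<close>.\<close>
definition XY_switch :: "real \<Rightarrow> real \<Rightarrow> real \<Rightarrow> real" where
  "XY_switch u1 u2 \<gamma> = (c_last u2 \<gamma> + u1 - 1) / (u1 + u2)"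

lemma XY_switch_diff:
  assumes "u1 \<ge> 1" "u2 \<ge> 1" "\<gamma> > 1"
  shows "XY_switch u1 u2 \<gamma> - 1 = (\<gamma>\<^sup>2 - 1) * (u2 * \<gamma>\<^sup>2 - 1) / (\<gamma>\<^sup>2 * (u1 + u2))"
    "\<gamma>\<^sup>2 - XY_switch u1 u2 \<gamma> = (\<gamma>\<^sup>2 - 1) * (u1 * \<gamma>\<^sup>2 + 1) / (\<gamma>\<^sup>2 * (u1 + u2))"
proof -
  have "u1 + u2 > 0" "\<gamma>\<^sup>2 > 0" using assms by auto
  then show "XY_switch u1 u2 \<gamma> - 1 = (\<gamma>\<^sup>2 - 1) * (u2 * \<gamma>\<^sup>2 - 1) / (\<gamma>\<^sup>2 * (u1 + u2))"
    "\<gamma>\<^sup>2 - XY_switch u1 u2 \<gamma> = (\<gamma>\<^sup>2 - 1) * (u1 * \<gamma>\<^sup>2 + 1) / (\<gamma>\<^sup>2 * (u1 + u2))"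
    by (simp_all add: XY_switch_def c_last_def divide_simps) algebra+
qed

lemma XY_trajectory_time:
  assumes u: "u1 \<ge> 1" "u2 \<ge> 1" "\<gamma> > 1" and tr: "XY_trajectory u1 u2 \<gamma> \<tau> u x"
  shows "\<tau> 2 = T_zero u1 u2 \<gamma>"
proof -
  define p where "p = x (\<tau> 1)"
  define q where "q = (fst p)\<^sup>2"
  have bb: "bang_bang u1 u2 \<gamma> 1 (\<lambda>i. if even i then - u1 else u2) \<tau> u x"
    using tr by (simp add: XY_trajectory_def)
  have ends: "\<tau> 0 = 0" "x 0 = (1, 0)" "x (\<tau> 2) = (\<gamma>, 0)"
    using bb by (simp_all add: bang_bang_def steers_def numeral_2_eq_2)
  have ppos: "fst p > 0" using bang_bang_pos[OF bb, of 1] by (simp add: p_def)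
  note X = bang_bang_segment[OF bb, of 0, simplified] 
  note Y = bang_bang_segment[OF bb, of 1, simplified]
  have X1: "flow (- u1) (\<tau> 1) (1, 0) = p" "\<tau> 1 > 0"
    using X(1,2) u ends by (simp_all add: p_def)
  have Y1: "flow u2 (\<tau> 2 - \<tau> 1) p = (\<gamma>, 0)" "0 < \<tau> 2 - \<tau> 1" "\<tau> 2 - \<tau> 1 < pi / sqrt u2"
    using Y u ends by (simp_all add: p_def numeral_2_eq_2)
  have EX: "Y_first_integral (- u1) p = 1 - u1"
    using first_integral_flow[of "(1, 0)" "- u1" "\<tau> 1"] X1 u by (simp add: Y_first_integral_def)
  have EY: "Y_first_integral u2 p = c_last u2 \<gamma>"
    using first_integral_flow[OF ppos, of u2 "\<tau> 2 - \<tau> 1"] Y1 u by (simp add: first_integral_target)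
  have "(u1 + u2) * q = c_last u2 \<gamma> + u1 - 1"
    using EX EY by (simp add: Y_first_integral_def q_def algebra_simps)
  then have q: "q = XY_switch u1 u2 \<gamma>" using u by (simp add: XY_switch_def field_simps)
  have off: "offset (- u1) (1, 0) = (u1 + 1) / (2 * u1)"
    using u by (simp add: offset_start field_simps)
  have "offset (- u1) p = offset (- u1) (1, 0) * gcos (- u1) (\<tau> 1)"
    and mom: "momentum p = u1 * offset (- u1) (1, 0) * gsin (- u1) (\<tau> 1)"
    using flow_from_rest[of 1 "- u1" "\<tau> 1"] X1 u by simp_all
  moreover have "offset (- u1) p = (q - 1) + (u1 + 1) / (2 * u1)"
    using u unfolding offset_def EX q_def by (simp add: field_simps)
  ultimately have "(u1 + 1) / (2 * u1) * (gcos (- u1) (\<tau> 1) - 1) = q - 1"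
    by (simp add: off right_diff_distrib)
  then have "(gcos (- u1) (\<tau> 1) - 1) / 2 = u1 * (q - 1) / (u1 + 1)"
    using u by (simp add: divide_simps) algebra
  also have "\<dots> = u1 * (\<gamma>\<^sup>2 - 1) * (u2 * \<gamma>\<^sup>2 - 1) / (\<gamma>\<^sup>2 * (u1 + u2) * (u1 + 1))"
    unfolding q XY_switch_diff(1)[OF u] by simp
  finally have TX: "\<tau> 1 = 1 / sqrt u1 *
      arsinh (sqrt (u1 * (\<gamma>\<^sup>2 - 1) * (u2 * \<gamma>\<^sup>2 - 1) / (\<gamma>\<^sup>2 * (u1 + u2) * (u1 + 1))))"
    using half_angle_time_neg[of "- u1" "\<tau> 1"] X1(2) u by simp
  have "gsin (- u1) (\<tau> 1) > 0" using X1(2) u by (simp add: gsin_def)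
  then have mpos: "momentum p > 0" unfolding mom off using u by simp
  have A: "offset u2 (\<gamma>, 0) > 0" by (rule offset_target_pos) (use u in auto)
  then have cosY: "gcos u2 (\<tau> 2 - \<tau> 1) = offset u2 p / offset u2 (\<gamma>, 0)"
    and "gsin u2 (\<tau> 2 - \<tau> 1) = momentum p / (u2 * offset u2 (\<gamma>, 0))"
    using flow_to_rest[OF ppos, of \<gamma> u2 "\<tau> 2 - \<tau> 1"] Y1(1) u by simp_all
  then have "gsin u2 (\<tau> 2 - \<tau> 1) > 0" using mpos A u by simp
  then have TY: "\<tau> 2 - \<tau> 1 = arcsin (sqrt ((1 - gcos u2 (\<tau> 2 - \<tau> 1)) / 2)) / sqrt u2"
    using u Y1 by (intro half_angle_time_pos) auto
  have "offset u2 p = offset u2 (\<gamma>, 0) - (\<gamma>\<^sup>2 - q)"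
    by (simp add: offset_def EY first_integral_target q_def)
  then have "(1 - gcos u2 (\<tau> 2 - \<tau> 1)) / 2 = (\<gamma>\<^sup>2 - q) / (2 * offset u2 (\<gamma>, 0))"
    unfolding cosY using A by (simp add: field_simps)
  also have "\<dots> = u2 * (\<gamma>\<^sup>2 - 1) * (u1 * \<gamma>\<^sup>2 + 1) / ((u1 + u2) * (u2 * \<gamma> ^ 4 - 1))"
  proof -
    have "2 * offset u2 (\<gamma>, 0) = (u2 * \<gamma>^4 - 1) / (u2 * \<gamma>\<^sup>2)"
      using u offset_target by simp
    then show ?thesis using u unfolding q XY_switch_diff(2)[OF u] by (simp add: mult_ac)
  qed
  finally show ?thesis using TX TY by (simp add: T_zero_def)
qed

text \<open>The switching point is the intersection of the two orbits in the upper half plane. That it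
  exists, that is \<open>x2\<^sup>2 > 0\<close> there, rests on \<open>XY_switch u1 u2 \<gamma> > 1\<close>.\<close>
lemma XY_trajectory_exists:
  assumes u: "u1 \<ge> 1" "u2 \<ge> 1" "\<gamma> > 1"
  shows "\<exists>\<tau> u x. XY_trajectory u1 u2 \<gamma> \<tau> u x"
proof -
  define q where "q = XY_switch u1 u2 \<gamma>"
  have "1 < \<gamma>\<^sup>2" using u by (simp add: one_less_power)
  moreover have "\<gamma>\<^sup>2 > 0" "u1 + u2 > 0" using u by auto
  moreover have "\<gamma>\<^sup>2 \<le> u2 * \<gamma>\<^sup>2" using u by simp
  ultimately have "q - 1 > 0" unfolding q_def XY_switch_diff(1)[OF u]
    using u \<open>1 < \<gamma>\<^sup>2\<close> by (intro divide_pos_pos mult_pos_pos) linarith+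
  then have q: "q > 1" by simp
  define h where "h = (q - 1) * (u1 + 1 / q)"
  have h: "h > 0" unfolding h_def using q u by (intro mult_pos_pos add_pos_pos) auto
  define p where "p = (sqrt q, sqrt h)"
  have p: "fst p > 0" "snd p > 0" using q h by (auto simp: p_def)
  have "h = 1 - u1 + u1 * q - 1 / q" unfolding h_def using q by (simp add: field_simps)
  then have EX: "Y_first_integral (- u1) p = 1 - u1"
    and EY: "Y_first_integral u2 p = 1 - u1 + (u1 + u2) * q"
    using q h by (simp_all add: Y_first_integral_def p_def algebra_simps)
  have "(u1 + u2) * q = c_last u2 \<gamma> + u1 - 1" using u by (simp add: q_def XY_switch_def)
  then have EY: "Y_first_integral u2 p = Y_first_integral u2 (\<gamma>, 0)"
    unfolding EY first_integral_target by simp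
  have EX: "Y_first_integral (- u1) (1, 0) = Y_first_integral (- u1) p"
    unfolding EX by (simp add: Y_first_integral_def)
  obtain t1 where t1: "0 < t1" "flow (- u1) t1 (1, 0) = p" "inj_on (\<lambda>t. flow (- u1) t (1, 0)) {0..t1}"
    using X_reachable[OF _ p(1) _ EX _ p(2)] u by auto
  have "p \<noteq> (\<gamma>, 0)" using p by auto
  then obtain t2 where t2: "0 < t2" "flow u2 t2 p = (\<gamma>, 0)" "inj_on (\<lambda>t. flow u2 t p) {0..t2}"
    using Y_reachable[OF p(1) _ _ EY] u by auto
  define y where "y = (\<lambda>i::nat. if i = 0 then (1, 0) else if i = 1 then p else (\<gamma>, 0))"
  have "\<exists>\<tau> u x. bang_bang u1 u2 \<gamma> 1 (\<lambda>i. if even i then - u1 else u2) \<tau> u x \<and> (\<forall>i\<le>1. x (\<tau> i) = y i)"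
    by (rule bang_bang_exists[where d = "\<lambda>i. if i = 0 then t1 else t2"])
       (use u t1 t2 p in \<open>auto simp: y_def le_Suc_eq\<close>)
  then show ?thesis by (auto simp: XY_trajectory_def)
qed

section \<open>Transits between switching rays\<close>

lemma snd_slope: "fst p > 0 \<Longrightarrow> snd p = slope p * fst p"
  by (simp add: slope_def)

lemma first_integral_slope:
  assumes "fst p > 0"
  shows "Y_first_integral a p = ((slope p)\<^sup>2 + a) * (fst p)\<^sup>2 + 1 / (fst p)\<^sup>2"
  by (simp add: Y_first_integral_def snd_slope[OF assms] algebra_simps power_mult_distrib)

text \<open>Along an orbit the values \<open>q = x1\<^sup>2\<close> with \<open>x2\<^sup>2 = s * x1\<^sup>2\<close> are roots of
  \<open>(s + a) * q + 1 / q = E\<close>. Equal roots with opposite slopes are mirror images, so the two states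
  realise different roots, whose product is \<open>1 / (s + a)\<close>. In the formula for the angle the
  amplitude then cancels and only \<open>s\<close> and \<open>a\<close> remain.\<close>
lemma slope_transit:
  assumes p: "fst p > 0" "fst p' > 0" and a: "a \<noteq> 0"
    and sl: "slope p * slope p' < 0" "(slope p)\<^sup>2 = s" "(slope p')\<^sup>2 = s"
    and mir: "p' \<noteq> mirror p" and fl: "flow a t p = p'"
  shows "(s + a) * ((fst p)\<^sup>2 * (fst p')\<^sup>2) = 1"
    "s + a > 0" "gcos a t = (s - a) / (s + a)" "gsin a t = - 2 * slope p / (s + a)"
proof -
  define q where "q = (fst p)\<^sup>2"
  define q' where "q' = (fst p')\<^sup>2"
  define y where "y = slope p"
  have q: "q > 0" "q' > 0" using p by (auto simp: q_def q'_def)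
  have "y \<noteq> 0" using sl(1) by (auto simp: y_def)
  have ysq: "y\<^sup>2 = s" using sl(2) by (simp add: y_def)
  have "slope p' = y \<or> slope p' = - y" using sl(2,3) by (metis power2_eq_iff y_def)
  then have y': "slope p' = - y" using sl(1) by (auto simp: y_def mult_less_0_iff)
  have E: "Y_first_integral a p = Y_first_integral a p'"
    using first_integral_flow[OF p(1) a, of t] fl by simp
  have Eq: "Y_first_integral a p = (s + a) * q + 1 / q" "Y_first_integral a p' = (s + a) * q' + 1 / q'"
    using first_integral_slope[OF p(1)] first_integral_slope[OF p(2)] sl(2,3) by (simp_all add: q_def q'_def)
  have "q \<noteq> q'"
  proof
    assume "q = q'"
    then have "fst p' = fst p" using p by (simp add: q_def q'_def power2_eq_iff_nonneg)
    then have "p' = mirror p" using snd_slope[OF p(1)] snd_slope[OF p(2)] y'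
      by (simp add: mirror_def prod_eq_iff y_def)
    then show False using mir by simp
  qed
  have "(s + a) * (q - q') = 1 / q' - 1 / q" using E unfolding Eq by (simp add: algebra_simps)
  also have "\<dots> = (q - q') / (q * q')" using q by (simp add: field_simps)
  finally have "(s + a) * (q - q') * (q * q') = q - q'" using q by simp
  then have "(s + a) * (q * q') * (q - q') = 1 * (q - q')" by (simp add: mult_ac)
  then have M: "(s + a) * (q * q') = 1" using \<open>q \<noteq> q'\<close> by (simp only: mult_cancel_right) simp
  then show "(s + a) * ((fst p)\<^sup>2 * (fst p')\<^sup>2) = 1" by (simp add: q_def q'_def)
  have qq: "q * q' > 0" using q by simp
  then show Mpos: "s + a > 0" using M by (metis zero_less_mult_pos2 zero_less_one)
  have N: "amplitude a p \<noteq> 0"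
  proof (cases "a > 0")
    case True
    have "p \<noteq> p'" using y' \<open>y \<noteq> 0\<close> by (auto simp: y_def)
    then show ?thesis using amplitude_pos_distinct[OF p True E] by simp
  next
    case False
    then show ?thesis using amplitude_pos_neg[OF p(1), of a] a by simp
  qed
  define S where "S = q + q'"
  define K where "K = s + a"
  have K: "K > 0" "K * (q * q') = 1" using Mpos M by (simp_all add: K_def)
  have qq': "q * q' = 1 / K" using K by (simp add: field_simps)
  have KS: "Y_first_integral a p = K * S"
  proof -
    have "1 / q = K * q'" using K q by (simp add: field_simps)
    then show ?thesis unfolding Eq(1) by (simp add: K_def S_def algebra_simps)
  qed
  (* Both numerators of the angle formula and the amplitude turn out to be multiples of R. *)
  define R where "R = K * S\<^sup>2 / (4 * a\<^sup>2) - 1 / (a * K)"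
  have ampl: "amplitude a p = K * R"
    unfolding amplitude_def offset_norm[OF p(1) a] KS R_def using K a
    by (simp add: field_simps power2_eq_square)
  then have R: "R \<noteq> 0" using N by auto
  have off: "offset a p = q - K * S / (2 * a)" "offset a p' = q' - K * S / (2 * a)"
    using E KS by (simp_all add: offset_def q_def q'_def)
  have mom: "momentum p = y * q" "momentum p' = - y * q'"
    using snd_slope[OF p(1)] snd_slope[OF p(2)] y'
    by (simp_all add: momentum_def q_def q'_def y_def power2_eq_square)
  have "offset a p * offset a p' + momentum p * momentum p' / a
      = q * q' * (1 - y\<^sup>2 / a) - K * S * S / (2 * a) + (K * S)\<^sup>2 / (4 * a\<^sup>2)"
    unfolding off mom by (simp add: S_def field_simps power2_eq_square a)
  also have "\<dots> = (s - a) * R"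
    unfolding qq' ysq R_def using a K(1) unfolding K_def
    by (simp add: divide_simps) algebra
  finally have num1: "offset a p * offset a p' + momentum p * momentum p' / a = (s - a) * R" .
  have "momentum p * offset a p' - offset a p * momentum p' = y * (2 * (q * q') - K * S * S / (2 * a))"
    unfolding off mom by (simp add: S_def algebra_simps add_divide_distrib)
  also have "\<dots> = - 2 * y * a * R"
    unfolding qq' R_def using a K(1) by (simp add: divide_simps) algebra
  finally have num2: "momentum p * offset a p' - offset a p * momentum p' = - 2 * y * a * R" .
  note angle = flow_eq_iff_angle[OF p a E N, THEN iffD1, OF fl, unfolded num1 num2 ampl]
  show "gcos a t = (s - a) / (s + a)" "gsin a t = - 2 * slope p / (s + a)"
    using angle R a K(1) by (simp_all add: K_def y_def)
qed

text \<open>The direction of the transit is forced: \<open>gsin\<close> is positive at positive times, so the slope goes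
  from negative to positive. Thus every \<open>X\<close>-segment leads from below the axis to above it.\<close>
lemma X_transit:
  assumes "fst p > 0" "fst p' > 0" "u1 > 0" "t > 0"
    "slope p * slope p' < 0" "(slope p)\<^sup>2 = s" "(slope p')\<^sup>2 = s"
    "p' \<noteq> mirror p" "flow (- u1) t p = p'"
  shows "slope p < 0" "slope p' > 0" "u1 < s" "(s - u1) * ((fst p)\<^sup>2 * (fst p')\<^sup>2) = 1" "t = T_X u1 s"
proof -
  have a: "- u1 \<noteq> 0" using assms by simp
  note tr = slope_transit[OF assms(1,2) a assms(5-9)]
  show "u1 < s" "(s - u1) * ((fst p)\<^sup>2 * (fst p')\<^sup>2) = 1" using tr by simp_all
  have "gsin (- u1) t > 0" using assms(3,4) by (simp add: gsin_def)
  then show "slope p < 0" using tr(2,4) by (simp add: zero_less_divide_iff divide_less_0_iff)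
  then show "slope p' > 0" using assms(5) by (simp add: mult_less_0_iff)
  show "t = T_X u1 s" using time_from_gcos_neg[of "- u1" t] assms tr(3) by (simp add: T_X_def)
qed

text \<open>Here \<open>gsin\<close> is negative: the transit from positive to negative slope takes more than half a
  revolution. This explains the term \<open>2 * pi - arccos\<close> in \<open>T_Y\<close>.\<close>
lemma Y_transit:
  assumes "fst p > 0" "fst p' > 0" "u2 > 0" "0 < t" "t < pi / sqrt u2" "slope p > 0"
    "slope p * slope p' < 0" "(slope p)\<^sup>2 = s" "(slope p')\<^sup>2 = s"
    "p' \<noteq> mirror p" "flow u2 t p = p'"
  shows "(s + u2) * ((fst p)\<^sup>2 * (fst p')\<^sup>2) = 1" "t = T_Y u2 s"
proof -
  have a: "u2 \<noteq> 0" using assms by simp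
  note tr = slope_transit[OF assms(1,2) a assms(7-11)]
  show "(s + u2) * ((fst p)\<^sup>2 * (fst p')\<^sup>2) = 1" by (rule tr(1))
  have "gsin u2 t < 0" using tr(2,4) assms(6) by (simp add: divide_less_0_iff)
  then show "t = T_Y u2 s" using time_from_gcos_pos(2)[OF assms(3-5)] tr(3) by (simp add: T_Y_def)
qed

section \<open>Roots of the switching equations\<close>

lemma discriminant_eq:
  fixes c :: real
  assumes "z + w = c" "z * w = M" shows "sqrt (c\<^sup>2 - 4 * M) = \<bar>z - w\<bar>"
proof -
  have "c\<^sup>2 - 4 * M = (z - w)\<^sup>2" using assms by (simp add: power2_eq_square algebra_simps flip: assms)
  then show ?thesis by simp
qed

text \<open>The pairs \<open>z, w\<close> and \<open>Y, y\<close> have the same product, and the closer pair has the smaller sum. If \<open>Y\<close>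
  were the smaller member of its pair, then \<open>z < Y \<le> y\<close> would place \<open>Y\<close> and \<open>y\<close> between \<open>z\<close> and \<open>w\<close>,
  so their sum \<open>c'\<close> could not exceed \<open>c\<close>.\<close>
lemma last_switching_outer:
  fixes c c' :: real
  assumes "z + w = c" "z * w = M" "Y + y = c'" "Y * y = M" "c < c'" 
    and "0 < r" "r < 1" "z = Y * r" "0 < Y" "0 < y"
  shows "y < Y"
proof (rule ccontr)
  assume "\<not> ?thesis"
  then have "Y \<le> y" by simp
  have "z < Y" using assms by simp
  then have "(Y - z) * (y - z) > 0" using \<open>Y \<le> y\<close> by simp
  moreover have "(Y - z) * (y - z) = z * (c - c')"
    using assms by (simp add: algebra_simps flip: assms(1,3))
  moreover have "z > 0" using assms by simp
  ultimately show False using assms(5) by (simp add: zero_less_mult_iff)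
qed

lemma c_first_less_c_last:
  assumes "u2 \<ge> 1" "\<gamma> > 1" shows "c_first u2 < c_last u2 \<gamma>"
proof -
  have "\<gamma>\<^sup>2 > 1" using assms by (simp add: one_less_power)
  moreover from this have "1 / \<gamma>\<^sup>2 < u2" using assms(1) by (smt (verit) divide_less_eq_1_pos)
  ultimately have "(\<gamma>\<^sup>2 - 1) * (u2 - 1 / \<gamma>\<^sup>2) > 0" by simp
  moreover have "(\<gamma>\<^sup>2 - 1) * (u2 - 1 / \<gamma>\<^sup>2) = c_last u2 \<gamma> - c_first u2"
    using assms by (simp add: c_last_def c_first_def field_simps)
  ultimately show ?thesis by simp
qed

section \<open>Spiral trajectories\<close>

locale turns =
  fixes u1 u2 \<gamma> s :: real and n :: nat and \<tau> :: "nat \<Rightarrow> real" and u :: "real \<Rightarrow> real"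
    and x :: "real \<Rightarrow> real \<times> real"
  assumes u: "u1 \<ge> 1" "u2 \<ge> 1" "\<gamma> > 1" and tr: "turn_trajectory u1 u2 \<gamma> n s \<tau> u x"
begin

definition sq :: "nat \<Rightarrow> real" where "sq i = (fst (x (\<tau> i)))\<^sup>2"

definition ratio :: real where "ratio = (s - u1) / (s + u2)"

lemma n_ge_1: "n \<ge> 1" using tr by (simp add: turn_trajectory_def)

lemma segments: "bang_bang u1 u2 \<gamma> (2 * n) (\<lambda>i. if even i then u2 else - u1) \<tau> u x"
  using tr by (simp add: turn_trajectory_def)

lemma start: "\<tau> 0 = 0" "x 0 = (1, 0)" and finish: "x (\<tau> (2 * n + 1)) = (\<gamma>, 0)"
  using segments by (simp_all add: bang_bang_def steers_def)

lemma state_pos: "i \<le> 2 * n + 1 \<Longrightarrow> fst (x (\<tau> i)) > 0"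
  using bang_bang_pos[OF segments] by simp

lemma sq_pos: "i \<le> 2 * n + 1 \<Longrightarrow> sq i > 0"
  using state_pos[of i] by (auto simp: sq_def)

lemma slope_sq: "1 \<le> i \<Longrightarrow> i \<le> 2 * n \<Longrightarrow> (slope (x (\<tau> i)))\<^sup>2 = s"
  using tr by (simp add: turn_trajectory_def)

lemma X_segment:
  assumes "odd i" "i < 2 * n"
  shows "slope (x (\<tau> i)) < 0" "slope (x (\<tau> (Suc i))) > 0" "u1 < s"
    "(s - u1) * (sq i * sq (Suc i)) = 1" "\<tau> (Suc i) - \<tau> i = T_X u1 s"
proof -
  have i: "1 \<le> i" using assms(1) by (cases i) auto
  have c: "slope (x (\<tau> i)) * slope (x (\<tau> (Suc i))) < 0" "x (\<tau> (Suc i)) \<noteq> mirror (x (\<tau> i))"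
    using tr assms i by (auto simp: turn_trajectory_def)
  have f: "flow (- u1) (\<tau> (Suc i) - \<tau> i) (x (\<tau> i)) = x (\<tau> (Suc i))" "\<tau> (Suc i) - \<tau> i > 0"
    using bang_bang_segment(1,2)[OF segments, of i] assms u by simp_all
  note X = X_transit[OF state_pos state_pos _ f(2) c(1) slope_sq slope_sq c(2) f(1)]
  show "slope (x (\<tau> i)) < 0" "slope (x (\<tau> (Suc i))) > 0" "u1 < s"
    "(s - u1) * (sq i * sq (Suc i)) = 1" "\<tau> (Suc i) - \<tau> i = T_X u1 s"
    using X u i assms by (simp_all add: sq_def)
qed

lemma Y_segment:
  assumes "even i" "1 \<le> i" "i < 2 * n"
  shows "(s + u2) * (sq i * sq (Suc i)) = 1" "\<tau> (Suc i) - \<tau> i = T_Y u2 s"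
proof -
  have c: "slope (x (\<tau> i)) * slope (x (\<tau> (Suc i))) < 0" "x (\<tau> (Suc i)) \<noteq> mirror (x (\<tau> i))"
    using tr assms by (auto simp: turn_trajectory_def)
  have f: "flow u2 (\<tau> (Suc i) - \<tau> i) (x (\<tau> i)) = x (\<tau> (Suc i))" "\<tau> (Suc i) - \<tau> i > 0"
     "\<tau> (Suc i) - \<tau> i < pi / sqrt u2"
    using bang_bang_segment[OF segments, of i] assms u by simp_all
  have sl: "slope (x (\<tau> i)) > 0" using X_segment(2)[of "i - 1"] assms by simp
  note Y = Y_transit[OF state_pos state_pos _ f(2,3) sl c(1) slope_sq slope_sq c(2) f(1)]
  show "(s + u2) * (sq i * sq (Suc i)) = 1" "\<tau> (Suc i) - \<tau> i = T_Y u2 s"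
    using Y u assms by (simp_all add: sq_def)
qed

lemma s_gt: "u1 < s" using X_segment(3)[of 1] n_ge_1 by simp

lemma ratio: "0 < ratio" "ratio < 1"
  using s_gt u by (simp_all add: ratio_def)

text \<open>A transit along an \<open>X\<close>-segment followed by one along a \<open>Y\<close>-segment multiplies \<open>x1\<^sup>2\<close> by \<open>ratio\<close>,
  since the two products of neighbours are \<open>1 / (s - u1)\<close> and \<open>1 / (s + u2)\<close>.\<close>
lemma sq_odd: "k < n \<Longrightarrow> sq (2 * k + 1) = sq 1 * ratio ^ k"
proof (induction k)
  case (Suc k)
  have M: "s - u1 > 0" "s + u2 > 0" using s_gt u by auto
  have q: "sq (2 * k + 1) > 0" "sq (2 * k + 2) > 0" "sq (2 * k + 3) > 0"
    using Suc.prems by (auto intro!: sq_pos)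
  have 1: "(s - u1) * (sq (2 * k + 1) * sq (2 * k + 2)) = 1" using X_segment(4)[of "2 * k + 1"] Suc.prems by simp
  have "(s + u2) * (sq (2 * k + 2) * sq (2 * k + 3)) = 1" 
    using Y_segment(1)[of "2 * k + 2"] Suc.prems by (simp add: numeral_3_eq_3)
  with 1 have "(s + u2) * sq (2 * k + 3) * sq (2 * k + 2) = (s - u1) * sq (2 * k + 1) * sq (2 * k + 2)"
    by (simp add: mult_ac)
  then have "(s + u2) * sq (2 * k + 3) = (s - u1) * sq (2 * k + 1)" using q(2) by simp
  then have "sq (2 * k + 3) = sq (2 * k + 1) * ratio" using M by (simp add: ratio_def field_simps)
  then show ?case using Suc by (simp add: numeral_3_eq_3)
qed simp

lemma sq_last: "(s + u2) * sq (2 * n) * (sq 1 * ratio ^ n) = 1"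
proof -
  obtain k where k: "n = Suc k" using n_ge_1 by (cases n) auto
  have M: "s - u1 > 0" "s + u2 > 0" using s_gt u by auto
  have "(s - u1) * (sq (2 * k + 1) * sq (2 * k + 2)) = 1" using X_segment(4)[of "2 * k + 1"] k by simp
  then have "(s - u1) * (sq 1 * ratio ^ k * sq (2 * n)) = 1" using sq_odd[of k] k by simp
  moreover have "(s + u2) * ratio = s - u1" using M by (simp add: ratio_def)
  moreover have "(s + u2) * sq (2 * n) * (sq 1 * ratio ^ n) = (s + u2) * ratio * (sq 1 * ratio ^ k * sq (2 * n))"
    by (simp add: k mult_ac)
  ultimately show ?thesis by simp
qed

lemma times_sum: "k < n \<Longrightarrow> \<tau> (2 * k + 2) - \<tau> 1 = (real k + 1) * T_X u1 s + real k * T_Y u2 s"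
proof (induction k)
  case 0
  then show ?case using X_segment(5)[of 1] by (simp add: numeral_2_eq_2)
next
  case (Suc k)
  have "\<tau> (2 * k + 3) - \<tau> (2 * k + 2) = T_Y u2 s"
    using Y_segment(2)[of "2 * k + 2"] Suc.prems by (simp add: numeral_3_eq_3)
  moreover have "2 * k + 4 = Suc (2 * k + 3)" by simp
  then have "\<tau> (2 * k + 4) - \<tau> (2 * k + 3) = T_X u1 s"
    using X_segment(5)[of "2 * k + 3"] Suc.prems by (simp only:) simp
  ultimately have "\<tau> (2 * k + 4) - \<tau> 1 = (real k + 2) * T_X u1 s + (real k + 1) * T_Y u2 s"
    using Suc by (simp add: algebra_simps)
  then show ?case by (simp add: eval_nat_numeral algebra_simps)
qed

lemma middle_time: "\<tau> (2 * n) - \<tau> 1 = real n * T_X u1 s + (real n - 1) * T_Y u2 s"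
proof -
  obtain k where k: "n = Suc k" using n_ge_1 by (cases n) auto
  show ?thesis using times_sum[of k] by (simp add: k algebra_simps)
qed

lemma first_segment_integral: 
  assumes "t \<in> {\<tau> 0..\<tau> 1}" shows "Y_first_integral u2 (x t) = c_first u2"
  using bang_bang_flow[OF segments, of 0 t] assms u start first_integral_flow[of "(1, 0)" u2 "t - \<tau> 0"]
  by (simp add: first_integral_start)

lemma last_segment_integral: 
  assumes "t \<in> {\<tau> (2 * n)..\<tau> (2 * n + 1)}" shows "Y_first_integral u2 (x t) = c_last u2 \<gamma>"
proof -
  have *: "Y_first_integral u2 (x r) = Y_first_integral u2 (x (\<tau> (2 * n)))"
    if "r \<in> {\<tau> (2 * n)..\<tau> (2 * n + 1)}" for r
    using bang_bang_flow[OF segments, of "2 * n" r] that u 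
      first_integral_flow[OF state_pos, of "2 * n" u2 "r - \<tau> (2 * n)"] by simp
  have "\<tau> (2 * n) \<le> \<tau> (2 * n + 1)" using assms by simp
  then show ?thesis using *[OF assms] *[of "\<tau> (2 * n + 1)"]
    unfolding finish first_integral_target by simp
qed

text \<open>The numbers \<open>1 / sq 1\<close> and \<open>(s + u2) * sq 1\<close> have the sum \<open>c_first u2\<close> and the product
  \<open>s + u2\<close>, so they are the two roots of a known quadratic equation. The larger one is \<open>1 / sq 1\<close> exactly if the first switching is the inner one.\<close>
lemma first_roots: "1 / sq 1 + (s + u2) * sq 1 = c_first u2"
proof -
  have "\<tau> 0 \<le> \<tau> 1" using bang_bang_times[OF segments, of 0 1] by simp
  then have "Y_first_integral u2 (x (\<tau> 1)) = c_first u2" by (intro first_segment_integral) simp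
  then show ?thesis using first_integral_slope[OF state_pos, of 1 u2] slope_sq[of 1] n_ge_1 by (simp add: sq_def)
qed

lemma last_roots: "(s + u2) * sq (2 * n) + 1 / sq (2 * n) = c_last u2 \<gamma>"
proof -
  have "\<tau> (2 * n) \<le> \<tau> (2 * n + 1)" using bang_bang_times[OF segments, of "2 * n" "2 * n + 1"] by simp
  then have "Y_first_integral u2 (x (\<tau> (2 * n))) = c_last u2 \<gamma>" by (intro last_segment_integral) simp
  then show ?thesis using first_integral_slope[OF state_pos, of "2 * n" u2] slope_sq[of "2 * n"] n_ge_1 by (simp add: sq_def)
qed

text \<open>The two roots of the first segment are real, so the discriminant is nonnegative.\<close>
lemma s_le: "s \<le> s_plus u2"
proof -
  define z where "z = 1 / sq 1"
  define w where "w = (s + u2) * sq 1"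
  have zw: "z * w = s + u2" using sq_pos[of 1] by (simp add: z_def w_def)
  have c: "z + w = u2 + 1" using first_roots by (simp add: z_def w_def c_first_def)
  have "(z + w)\<^sup>2 - 4 * (z * w) = (z - w)\<^sup>2" by (simp add: power2_eq_square algebra_simps)
  then have "4 * (s + u2) \<le> (u2 + 1)\<^sup>2" unfolding zw c using zero_le_power2[of "z - w"] by linarith
  then show ?thesis by (simp add: s_plus_def power2_eq_square algebra_simps)
qed

text \<open>At \<open>u2 = 1\<close> the start would be an equilibrium of the \<open>Y\<close>-flow. Excluding this gives the start a
  positive offset, against which the angle of the first segment is measured.\<close>
lemma u2_gt: "u2 > 1"
proof (rule ccontr)
  assume "\<not> ?thesis"
  then have "u2 = 1" using u by simp
  then show False using s_le s_gt u by (simp add: s_plus_def)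
qed

lemma last_outer: "1 / sq (2 * n) < (s + u2) * sq (2 * n)"
proof (rule last_switching_outer)
  have q: "sq 1 > 0" "sq (2 * n) > 0" by (auto intro!: sq_pos)
  show "1 / sq 1 + (s + u2) * sq 1 = c_first u2" by (rule first_roots)
  show "(s + u2) * sq (2 * n) + 1 / sq (2 * n) = c_last u2 \<gamma>" by (rule last_roots)
  show "1 / sq 1 * ((s + u2) * sq 1) = s + u2" "(s + u2) * sq (2 * n) * (1 / sq (2 * n)) = s + u2"
    using q by simp_all
  show "c_first u2 < c_last u2 \<gamma>" using c_first_less_c_last u by blast
  show "0 < ratio ^ n" using ratio by simp
  show "ratio ^ n < 1" using ratio n_ge_1 by (simp add: power_less_one_iff)
  show "1 / sq 1 = (s + u2) * sq (2 * n) * ratio ^ n" using sq_last q by (simp add: field_simps)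
  show "0 < (s + u2) * sq (2 * n)" "0 < 1 / sq (2 * n)" using q s_gt u by simp_all
qed

lemma last_sqrt: "sqrt ((c_last u2 \<gamma>)\<^sup>2 - 4 * (s + u2)) = (s + u2) * sq (2 * n) - 1 / sq (2 * n)"
  using discriminant_eq[OF last_roots, of "s + u2"] last_outer sq_pos[of "2 * n"] by simp

lemma first_sqrt: "sqrt ((c_first u2)\<^sup>2 - 4 * (s + u2)) = \<bar>1 / sq 1 - (s + u2) * sq 1\<bar>"
  using discriminant_eq[OF first_roots, of "s + u2"] sq_pos[of 1] by simp

lemma inner_iff: "inner_first_switching u2 (x (\<tau> 1)) \<longleftrightarrow> (s + u2) * sq 1 \<le> 1 / sq 1"
proof -
  have q: "sq 1 > 0" by (auto intro!: sq_pos)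
  have c: "c_first u2 > 0" using u by (simp add: c_first_def)
  have "inner_first_switching u2 (x (\<tau> 1)) \<longleftrightarrow> sq 1 \<le> 2 / c_first u2"
    by (simp add: inner_first_switching_def sq_def)
  also have "\<dots> \<longleftrightarrow> c_first u2 \<le> 2 * (1 / sq 1)" using q c by (simp add: field_simps)
  also have "\<dots> \<longleftrightarrow> (s + u2) * sq 1 \<le> 1 / sq 1" unfolding first_roots[symmetric] by linarith
  finally show ?thesis .
qed

text \<open>The last switching point being the outer one, the denominator of the equation is always
  \<open>2 * (s + u2) * sq (2 * n)\<close>. The numerator is twice the larger of the two roots belonging to the
  first segment, and \<open>sq_last\<close> says that the equation becomes true if the numerator is replaced by \<open>2 / sq 1\<close>.\<close>
lemma turn_equation_iff: "turn_equation u1 u2 \<gamma> n s \<longleftrightarrow> inner_first_switching u2 (x (\<tau> 1))"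
proof -
  have q: "sq 1 > 0" "sq (2 * n) > 0" by (auto intro!: sq_pos)
  have Y: "(s + u2) * sq (2 * n) > 0" using q s_gt u by simp
  have z: "1 / sq 1 = (s + u2) * sq (2 * n) * ratio ^ n" using sq_last q by (simp add: field_simps)
  have "c_last u2 \<gamma> + sqrt ((c_last u2 \<gamma>)\<^sup>2 - 4 * (s + u2)) = 2 * ((s + u2) * sq (2 * n))"
    using last_sqrt last_roots by linarith
  then have "turn_equation u1 u2 \<gamma> n s \<longleftrightarrow>
      (c_first u2 + sqrt ((c_first u2)\<^sup>2 - 4 * (s + u2))) / (2 * ((s + u2) * sq (2 * n))) = ratio ^ n"
    using s_gt s_le by (simp add: turn_equation_def ratio_def Let_def)
  also have "\<dots> \<longleftrightarrow> c_first u2 + sqrt ((c_first u2)\<^sup>2 - 4 * (s + u2)) = 2 * (1 / sq 1)"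
  proof -
    have "a / (2 * y) = r \<longleftrightarrow> a = 2 * (y * r)" if "y > 0" for a y r :: real
      using that by (simp add: field_simps)
    from this[OF Y] show ?thesis unfolding z .
  qed
  also have "\<dots> \<longleftrightarrow> (s + u2) * sq 1 \<le> 1 / sq 1"
    unfolding first_sqrt using first_roots by (auto simp: abs_if)
  finally show ?thesis using inner_iff by simp
qed

text \<open>The last switching point lies above the axis, so the target is reached within half a revolution
  and the angle is the arc cosine itself. That \<open>(s + u2) * sq (2 * n)\<close> is the larger root gives
  the square root its sign.\<close>
lemma final_time: "\<tau> (2 * n + 1) - \<tau> (2 * n) = T_F u2 \<gamma> s"
proof -
  define t where "t = \<tau> (2 * n + 1) - \<tau> (2 * n)"
  define p where "p = x (\<tau> (2 * n))"
  have p: "fst p > 0" using state_pos by (simp add: p_def)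
  have f: "flow u2 t p = (\<gamma>, 0)" "t > 0" "t < pi / sqrt u2"
    using bang_bang_segment[OF segments, of "2 * n"] u finish by (simp_all add: p_def t_def)
  have A: "offset u2 (\<gamma>, 0) > 0" by (rule offset_target_pos) (use u in auto)
  have g: "gcos u2 t = offset u2 p / offset u2 (\<gamma>, 0)" "gsin u2 t = momentum p / (u2 * offset u2 (\<gamma>, 0))"
    using flow_to_rest[OF p _ _ _ f(1)] A u by simp_all
  have "slope p > 0" using X_segment(2)[of "2 * n - 1"] n_ge_1 by (simp add: p_def)
  then have "momentum p > 0" using p by (simp add: momentum_def slope_def zero_less_divide_iff)
  then have "gsin u2 t > 0" unfolding g using A u by simp
  then have t: "t = arccos (gcos u2 t) / (2 * sqrt u2)"
    using f u by (intro time_from_gcos_pos) auto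
  define q where "q = sq (2 * n)"
  define K where "K = s + u2"
  have q: "q > 0" by (auto simp: q_def intro!: sq_pos)
  have K: "K > 0" using s_gt u by (simp add: K_def)
  define c where "c = c_last u2 \<gamma>"
  define B where "B = sqrt (c\<^sup>2 - 4 * u2)"
  have off: "2 * u2 * offset u2 (\<gamma>, 0) = B"
  proof -
    have "B = \<bar>u2 * \<gamma>\<^sup>2 - 1 / \<gamma>\<^sup>2\<bar>"
      unfolding B_def by (rule discriminant_eq) (use u in \<open>auto simp: c_def c_last_def\<close>)
    moreover have "2 * u2 * offset u2 (\<gamma>, 0) = u2 * \<gamma>\<^sup>2 - 1 / \<gamma>\<^sup>2"
      using u by (simp add: offset_def first_integral_target c_last_def field_simps)
    moreover have "2 * u2 * offset u2 (\<gamma>, 0) > 0" using A u by simp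
    ultimately show ?thesis by linarith
  qed
  have "p = x (\<tau> (2 * n))" by (simp add: p_def)
  then have "offset u2 p = q - c / (2 * u2)"
    using last_segment_integral[of "\<tau> (2 * n)"] f(2) by (simp add: offset_def q_def sq_def c_def t_def)
  then have offp: "2 * u2 * offset u2 p = 2 * u2 * q - c" using u by (simp add: field_simps)
  have "gcos u2 t = (2 * u2 * offset u2 p) / (2 * u2 * offset u2 (\<gamma>, 0))" unfolding g using u by simp
  also have "\<dots> = (2 * u2 * q - c) / B" unfolding off offp ..
  also have "2 * u2 * q - c = (- s * c + u2 * sqrt (c\<^sup>2 - 4 * K)) / K"
  proof -
    have "c = K * q + 1 / q" "sqrt (c\<^sup>2 - 4 * K) = K * q - 1 / q"
      using last_roots last_sqrt by (simp_all add: K_def q_def c_def)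
    then have R: "sqrt (c\<^sup>2 - 4 * K) = 2 * (K * q) - c" by linarith
    have sK: "s = K - u2" by (simp add: K_def)
    have "- s * c + u2 * sqrt (c\<^sup>2 - 4 * K) = K * (2 * u2 * q - c)"
      unfolding R sK by (simp add: algebra_simps)
    then show ?thesis using K by simp
  qed
  finally have "gcos u2 t = (- s * c + u2 * sqrt (c\<^sup>2 - 4 * K)) / (K * B)" by simp
  then show ?thesis using t by (simp add: T_F_def Let_def c_def K_def B_def t_def)
qed

text \<open>The first switching point lies below the axis, so it is reached within half a revolution from
  the start. Here the inner position is needed to give the square root its sign.\<close>
lemma initial_time: 
  assumes "inner_first_switching u2 (x (\<tau> 1))"
  shows "\<tau> 1 - \<tau> 0 = T_I u2 s"
proof -
  define t where "t = \<tau> 1 - \<tau> 0"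
  define p where "p = x (\<tau> 1)"
  have p: "fst p > 0" using state_pos by (simp add: p_def)
  have f: "flow u2 t (1, 0) = p" "t > 0" "t < pi / sqrt u2"
    using bang_bang_segment[OF segments, of 0] u start by (simp_all add: p_def t_def)
  have off: "2 * u2 * offset u2 (1, 0) = u2 - 1" using u by (simp add: offset_start)
  have A: "offset u2 (1, 0) > 0" using u2_gt by (simp add: offset_start)
  have g: "offset u2 p = offset u2 (1, 0) * gcos u2 t" "momentum p = - u2 * offset u2 (1, 0) * gsin u2 t"
    using flow_from_rest[of 1 u2 t] f u by simp_all
  have "slope p < 0" using X_segment(1)[of 1] n_ge_1 by (simp add: p_def)
  then have "momentum p < 0" using p by (simp add: momentum_def slope_def mult_less_0_iff divide_less_0_iff)
  then have "(u2 * offset u2 (1, 0)) * gsin u2 t > 0" unfolding g by simp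
  moreover have "u2 * offset u2 (1, 0) > 0" using A u by simp
  ultimately have "gsin u2 t > 0" by (rule zero_less_mult_pos)
  then have t: "t = arccos (gcos u2 t) / (2 * sqrt u2)"
    using f u by (intro time_from_gcos_pos) auto
  define q where "q = sq 1"
  define K where "K = s + u2"
  have q: "q > 0" by (auto simp: q_def intro!: sq_pos)
  have K: "K > 0" using s_gt u by (simp add: K_def)
  define c where "c = c_first u2"
  have B: "sqrt (c\<^sup>2 - 4 * u2) = u2 - 1"
    using discriminant_eq[of u2 1 c u2] u by (simp add: c_def c_first_def)
  have "offset u2 p = q - c / (2 * u2)"
    using first_segment_integral[of "\<tau> 1"] f(2) by (simp add: offset_def q_def sq_def c_def p_def t_def)
  then have offp: "2 * u2 * offset u2 p = 2 * u2 * q - c" using u by (simp add: field_simps)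
  have "gcos u2 t = (2 * u2 * offset u2 p) / (2 * u2 * offset u2 (1, 0))" unfolding g using u A by simp
  also have "\<dots> = (2 * u2 * q - c) / (u2 - 1)" unfolding off offp ..
  also have "2 * u2 * q - c = - ((s * c + u2 * sqrt (c\<^sup>2 - 4 * K)) / K)"
  proof -
    have "c = K * q + 1 / q" "sqrt (c\<^sup>2 - 4 * K) = 1 / q - K * q"
      using first_roots first_sqrt assms[unfolded inner_iff] by (simp_all add: K_def q_def c_def)
    then have R: "sqrt (c\<^sup>2 - 4 * K) = c - 2 * (K * q)" by linarith
    have sK: "s = K - u2" by (simp add: K_def)
    have "s * c + u2 * sqrt (c\<^sup>2 - 4 * K) = - (K * (2 * u2 * q - c))"
      unfolding R sK by (simp add: algebra_simps)
    then show ?thesis using K by simp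
  qed
  finally have "gcos u2 t = - ((s * c + u2 * sqrt (c\<^sup>2 - 4 * K)) / (K * sqrt (c\<^sup>2 - 4 * u2)))"
    unfolding B by simp
  then show ?thesis using t by (simp add: T_I_def Let_def c_def K_def t_def)
qed

lemma total_time:
  assumes "turn_equation u1 u2 \<gamma> n s"
  shows "\<tau> (2 * n + 1) = T_turns u1 u2 \<gamma> n s"
  using initial_time middle_time final_time start assms turn_equation_iff by (simp add: T_turns_def)

end

section \<open>Uniqueness of the solution of the transcendental equation\<close>

text \<open>As \<open>M\<close> grows, both square roots decrease. They do so by \<open>4 * (M2 - M1)\<close> divided by the sum of the
  old and the new root, hence faster in the numerator, where the roots are smaller; and the numerator is also the
  smaller quantity.\<close>
lemma root_ratio_antimono:
  fixes c c' :: real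
  assumes "0 < c" "c \<le> c'" "M1 < M2" "4 * M2 \<le> c\<^sup>2"
  shows "(c + sqrt (c\<^sup>2 - 4 * M2)) / (c' + sqrt (c'\<^sup>2 - 4 * M2))
    \<le> (c + sqrt (c\<^sup>2 - 4 * M1)) / (c' + sqrt (c'\<^sup>2 - 4 * M1))"
proof -
  have cc: "c\<^sup>2 \<le> c'\<^sup>2" using assms by (simp add: power_mono)
  then have disc: "4 * M1 < c\<^sup>2" "4 * M1 < c'\<^sup>2" "4 * M2 \<le> c'\<^sup>2" using assms by linarith+
  define R1 where "R1 = sqrt (c\<^sup>2 - 4 * M1)"
  define R2 where "R2 = sqrt (c\<^sup>2 - 4 * M2)"
  define R1' where "R1' = sqrt (c'\<^sup>2 - 4 * M1)"
  define R2' where "R2' = sqrt (c'\<^sup>2 - 4 * M2)"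
  have pos: "R1 > 0" "R2 \<ge> 0" "R1' > 0" "R2' \<ge> 0"
    using assms disc by (auto simp: R1_def R2_def R1'_def R2'_def)
  have mono: "R1 \<le> R1'" "R2 \<le> R2'"
    using assms cc by (auto simp: R1_def R2_def R1'_def R2'_def)
  have "(R1 - R2) * (R1 + R2) = R1\<^sup>2 - R2\<^sup>2" "(R1' - R2') * (R1' + R2') = R1'\<^sup>2 - R2'\<^sup>2"
    by (simp_all add: power2_eq_square algebra_simps)
  then have "(R1 - R2) * (R1 + R2) = 4 * (M2 - M1)" "(R1' - R2') * (R1' + R2') = 4 * (M2 - M1)"
    using assms disc by (simp_all add: R1_def R2_def R1'_def R2'_def)
  then have d: "R1 - R2 = 4 * (M2 - M1) / (R1 + R2)" "R1' - R2' = 4 * (M2 - M1) / (R1' + R2')"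
    using pos by (simp_all add: eq_divide_eq)
  have "R1' - R2' \<le> R1 - R2" unfolding d using assms(3) pos mono by (intro divide_left_mono) auto
  moreover have "0 \<le> R1' - R2'" unfolding d using assms(3) pos by simp
  ultimately have "(c + R2) * (R1' - R2') \<le> (c' + R2') * (R1 - R2)"
    using assms pos mono by (intro mult_mono) auto
  then have "(c + R2) * (c' + R1') \<le> (c + R1) * (c' + R2')" by (simp add: algebra_simps)
  moreover have "c' + R1' > 0" "c' + R2' > 0" using assms pos by auto
  moreover have "a / x \<le> b / y" if "a * y \<le> b * x" "y > 0" "x > 0" for a b x y :: real
    using that by (simp add: pos_divide_le_eq pos_le_divide_eq)
  ultimately have "(c + R2) / (c' + R2') \<le> (c + R1) / (c' + R1')" by blast
  then show ?thesis by (simp only: R1_def R2_def R1'_def R2'_def)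
qed

lemma s_plus_iff: "s \<le> s_plus u2 \<longleftrightarrow> 4 * (s + u2) \<le> (c_first u2)\<^sup>2"
  by (auto simp: s_plus_def c_first_def power2_eq_square algebra_simps)

lemma turn_equation_not_less:
  assumes u: "u1 \<ge> 1" "u2 \<ge> 1" "\<gamma> > 1" and n: "n \<ge> 1"
    and eq: "turn_equation u1 u2 \<gamma> n s" "turn_equation u1 u2 \<gamma> n s'"
  shows "\<not> s < s'"
proof
  assume "s < s'"
  have s: "u1 < s" "s' \<le> s_plus u2" using eq by (auto simp: turn_equation_def Let_def)
  have "((s' - u1) / (s' + u2)) ^ n \<le> ((s - u1) / (s + u2)) ^ n"
    using root_ratio_antimono[of "c_first u2" "c_last u2 \<gamma>" "s + u2" "s' + u2"]
      c_first_less_c_last[OF u(2,3)] eq u \<open>s < s'\<close> s(2)[unfolded s_plus_iff]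
    by (simp add: turn_equation_def Let_def c_first_def)
  moreover have "(s - u1) / (s + u2) < (s' - u1) / (s' + u2)"
  proof -
    have "(u1 + u2) * s < (u1 + u2) * s'" using \<open>s < s'\<close> u by simp
    then show ?thesis using s \<open>s < s'\<close> u by (simp add: divide_simps algebra_simps)
  qed
  then have "((s - u1) / (s + u2)) ^ n < ((s' - u1) / (s' + u2)) ^ n"
    using n s u by (intro power_strict_mono) auto
  ultimately show False by simp
qed

section \<open>Existence of spiral trajectories\<close>

text \<open>The switching points are forced by the relations between neighbouring values of \<open>x1\<^sup>2\<close>. The
  equation for \<open>s\<close> is what makes the last of them lie on the orbit through the target. Neighbours are
  never mirror images, because \<open>w \<le> z\<close>: the first switching point is the inner one, and the spiral
  moves the odd ones further inside.\<close>
lemma turn_trajectory_exists: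
  assumes u: "u1 \<ge> 1" "u2 \<ge> 1" "\<gamma> > 1" and n: "n \<ge> 1" and eq: "turn_equation u1 u2 \<gamma> n s"
  shows "\<exists>\<tau> u x. turn_trajectory u1 u2 \<gamma> n s \<tau> u x"
proof -
  define c where "c = c_first u2"
  define c' where "c' = c_last u2 \<gamma>"
  define M where "M = s + u2"
  define r where "r = (s - u1) / M"
  define z where "z = (c + sqrt (c\<^sup>2 - 4 * M)) / 2"
  define w where "w = (c - sqrt (c\<^sup>2 - 4 * M)) / 2"
  define Y where "Y = (c' + sqrt (c'\<^sup>2 - 4 * M)) / 2"
  have s: "u1 < s" "s \<le> s_plus u2" using eq by (simp_all add: turn_equation_def Let_def)
  have "(c + sqrt (c\<^sup>2 - 4 * M)) / (c' + sqrt (c'\<^sup>2 - 4 * M)) = r ^ n"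
    using eq by (simp add: turn_equation_def Let_def c_def c'_def M_def r_def)
  moreover have "(a / 2) / (b / 2) = a / b" for a b :: real by simp
  ultimately have zY: "z / Y = r ^ n" by (simp only: z_def Y_def)
  have M: "M > 0" using s u by (simp add: M_def)
  have r: "0 < r" "r < 1" using s u by (auto simp: r_def M_def)
  have Mr: "M * r = s - u1" using M by (simp add: r_def)
  have c: "0 < c" "c < c'" using u c_first_less_c_last by (auto simp: c_def c'_def c_first_def)
  then have cc: "c\<^sup>2 < c'\<^sup>2" by (simp add: power_strict_mono)
  have disc: "4 * M \<le> c\<^sup>2" using s(2) unfolding s_plus_iff by (simp add: c_def M_def)
  have zw: "z + w = c" "z * w = M" "w \<le> z"
    using disc by (simp_all add: z_def w_def field_simps power2_eq_square)
  have z: "z > 0" using c disc by (auto simp: z_def intro!: add_pos_nonneg)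
  have Y: "Y > 0" using c disc cc by (auto simp: Y_def intro!: add_pos_nonneg)
  have Yc: "Y + M / Y = c'"
  proof -
    have "Y * (c' - Y) = M"
      using disc cc by (simp add: Y_def field_simps power2_eq_square)
    then show ?thesis using Y by (simp add: field_simps)
  qed
  (* The squares of x1 at the switching points: q 1 = 1 / z, and the products of neighbours are
     alternately 1 / (s - u1) and 1 / (s + u2), where s - u1 = M * r. *)
  define q where "q = (\<lambda>i::nat. if odd i then r ^ (i div 2) / z else z / (M * r ^ (i div 2)))"
  have q: "q i > 0" for i using z M r by (simp add: q_def)
  have qodd: "(s - u1) * (q i * q (Suc i)) = 1" if "odd i" for i
  proof -
    have "(i + 1) div 2 = Suc (i div 2)" using that by (elim oddE) simp
    then show ?thesis using that z M r unfolding Mr[symmetric] by (simp add: q_def field_simps)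
  qed
  have qeven: "(s + u2) * (q i * q (Suc i)) = 1" if "even i" for i
  proof -
    have "(i + 1) div 2 = i div 2" using that by (elim evenE) simp
    then show ?thesis using that z M r unfolding M_def[symmetric] by (simp add: q_def field_simps)
  qed
  have qneq: "q i \<noteq> q (Suc i)" if "i \<ge> 1" for i
  proof
    assume eq: "q i = q (Suc i)"
    (* If two neighbours agreed, the square of their common value would be 1 / (s - u1), which
       exceeds 1 / M, or 1 / M. But w \<le> z bounds the square at odd indices by 1 / M, strictly from
       the second odd index on. *)
    have small: "M * (r ^ k / z)\<^sup>2 = (r ^ k)\<^sup>2 * (w / z)" for k
      using z by (simp add: field_simps power2_eq_square flip: zw(2))
    have wz: "w / z \<le> 1" "0 < w / z" using zw z M by (auto simp: zero_less_mult_iff)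
    show False
    proof (cases "odd i")
      case True
      have "(r ^ (i div 2))\<^sup>2 \<le> 1" using r by (simp add: power_le_one)
      then have "(r ^ (i div 2))\<^sup>2 * (w / z) \<le> 1" using wz by (intro mult_le_one) auto
      then have "M * (q i)\<^sup>2 \<le> 1" using True unfolding small[symmetric] by (simp add: q_def)
      moreover have "(s - u1) * (q i)\<^sup>2 = 1" using qodd[OF True] eq by (simp add: power2_eq_square)
      moreover have "(s - u1) * (q i)\<^sup>2 < M * (q i)\<^sup>2" using q[of i] u by (simp add: M_def)
      ultimately show False by simp
    next
      case False
      then have "i div 2 \<noteq> 0" "Suc i div 2 = i div 2" using that by (auto elim!: evenE)
      then have "(r ^ (i div 2))\<^sup>2 < 1" using r by (simp add: power_less_one_iff)
      then have "(r ^ (i div 2))\<^sup>2 * (w / z) < 1"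
        using wz mult_less_le_imp_less[of "(r ^ (i div 2))\<^sup>2" 1 "w / z" 1] by simp
      then have "M * (q (Suc i))\<^sup>2 < 1"
        using False \<open>Suc i div 2 = i div 2\<close> unfolding small[symmetric] by (simp add: q_def)
      moreover have "M * (q (Suc i))\<^sup>2 = 1" using qeven[of i] False eq by (simp add: power2_eq_square M_def)
      ultimately show False by simp
    qed
  qed
  define \<sigma> where "\<sigma> = (\<lambda>i::nat. if odd i then - sqrt s else sqrt s)"
  define y where "y = (\<lambda>i. if i = 0 then (1, 0) else if i = 2 * n + 1 then (\<gamma>, 0)
     else (sqrt (q i), \<sigma> i * sqrt (q i)))"
  have ends: "y 0 = (1, 0)" "y (2 * n + 1) = (\<gamma>, 0)" by (simp_all add: y_def)
  have s0: "s > 0" using s u by simp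
  have ypos: "fst (y i) > 0" for i using q u by (simp add: y_def)
  have ysl: "slope (y i) = \<sigma> i" and yq: "(fst (y i))\<^sup>2 = q i"
    if "1 \<le> i" "i \<le> 2 * n" for i
    using that q[of i] by (simp_all add: y_def slope_def less_imp_le)
  have ysnd: "snd (y i) = \<sigma> i * fst (y i)" if "1 \<le> i" "i \<le> 2 * n" for i
    using snd_slope[OF ypos] ysl[OF that] by simp
  have \<sigma>2: "(\<sigma> i)\<^sup>2 = s" for i using s0 by (simp add: \<sigma>_def)
  have yE: "Y_first_integral a (y i) = (s + a) * q i + 1 / q i" if "1 \<le> i" "i \<le> 2 * n" for i a
    using first_integral_slope[OF ypos] ysl[OF that] yq[OF that] \<sigma>2 by simp
  have balance: "K * p + 1 / p = K * p' + 1 / p'" if "K * (p * p') = 1" "p > 0" "p' > 0" for K p p' :: real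
  proof -
    have "1 / p = K * p'" "1 / p' = K * p" using that by (simp_all add: field_simps)
    then show ?thesis by simp
  qed
  define v where "v = (\<lambda>i::nat. if even i then u2 else - u1)"
  have "\<exists>d>0. flow (v i) d (y i) = y (Suc i) \<and> inj_on (\<lambda>t. flow (v i) t (y i)) {0..d}" if i: "i \<le> 2 * n" for i
  proof (cases "odd i")
    case True
    then have i': "1 \<le> i" "Suc i \<le> 2 * n" using i by presburger+
    have "Y_first_integral (- u1) (y i) = Y_first_integral (- u1) (y (Suc i))"
      using balance[OF qodd[OF True] q q] i' i by (simp add: yE)
    moreover have "snd (y i) \<le> 0" "snd (y (Suc i)) > 0"
      using True i i' ypos[of i] ypos[of "Suc i"] s0 by (simp_all add: ysnd \<sigma>_def)
    ultimately show ?thesis using X_reachable[OF ypos ypos, of "- u1" i "Suc i"] True u by (simp add: v_def)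
  next
    case False
    have E: "Y_first_integral u2 (y i) = Y_first_integral u2 (y (Suc i))"
    proof -
      consider "i = 0" | "i = 2 * n" | "1 \<le> i" "Suc i \<le> 2 * n" using i False by linarith
      then show ?thesis
      proof cases
        case 1
        have "Y_first_integral u2 (y 1) = M / z + z" using n by (simp add: yE q_def M_def)
        also have "M / z = w" using zw z by (simp add: field_simps)
        finally show ?thesis using zw 1 by (simp add: ends first_integral_start c_def)
      next
        case 2
        have "z = Y * r ^ n" using zY Y by (simp add: field_simps)
        then have "q (2 * n) = Y / M" using r by (simp add: q_def)
        then have "Y_first_integral u2 (y (2 * n)) = c'"
          using n M Y Yc by (simp add: yE flip: M_def)
        then show ?thesis using ends by (simp add: 2 first_integral_target c'_def)
      next
        case 3
        then show ?thesis using balance[OF qeven q q, of i] False by (simp add: yE)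
      qed
    qed
    have "snd (y (Suc i)) < snd (y i)"
    proof (cases "i = 0")
      case True
      then show ?thesis using n s0 q[of 1] by (simp add: y_def \<sigma>_def)
    next
      case nz: False
      then have "snd (y i) > 0" using False i s0 ypos[of i] by (simp add: ysnd \<sigma>_def)
      moreover have "snd (y (Suc i)) \<le> 0"
        using False i s0 q[of "Suc i"] by (simp add: y_def \<sigma>_def)
      ultimately show ?thesis by simp
    qed
    then have "y i \<noteq> y (Suc i)" by auto
    then show ?thesis using Y_reachable[OF ypos ypos _ E] False u by (simp add: v_def)
  qed
  then obtain d where d: "\<And>i. i \<le> 2 * n \<Longrightarrow> d i > 0 \<and> flow (v i) (d i) (y i) = y (Suc i) \<and>
      inj_on (\<lambda>t. flow (v i) t (y i)) {0..d i}"
    by metis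
  have "v i \<noteq> 0 \<and> - u1 \<le> v i \<and> v i \<le> u2" for i using u by (simp add: v_def)
  then have "\<exists>\<tau> uu x. bang_bang u1 u2 \<gamma> (2 * n) v \<tau> uu x \<and> (\<forall>i\<le>2 * n. x (\<tau> i) = y i)"
    using ends d ypos by (intro bang_bang_exists[where d = d]) simp_all
  then obtain \<tau> uu x where bb: "bang_bang u1 u2 \<gamma> (2 * n) v \<tau> uu x"
    and x: "\<And>i. i \<le> 2 * n \<Longrightarrow> x (\<tau> i) = y i"
    by blast
  have "turn_trajectory u1 u2 \<gamma> n s \<tau> uu x"
    unfolding turn_trajectory_def
  proof (intro conjI ballI)
    show "n \<ge> 1" by (rule n)
    show "bang_bang u1 u2 \<gamma> (2 * n) (\<lambda>i. if even i then u2 else - u1) \<tau> uu x" using bb by (simp add: v_def)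
  next
    fix i assume "i \<in> {1..2 * n}"
    then show "(slope (x (\<tau> i)))\<^sup>2 = s" using x ysl \<sigma>2 by simp
  next
    fix i assume i: "i \<in> {1..<2 * n}"
    then have xi: "x (\<tau> i) = y i" "x (\<tau> (Suc i)) = y (Suc i)" using x by simp_all
    show "slope (x (\<tau> i)) * slope (x (\<tau> (Suc i))) < 0"
      unfolding xi using i s0 by (simp add: ysl \<sigma>_def)
    show "x (\<tau> (Suc i)) \<noteq> mirror (x (\<tau> i))"
    proof
      assume "x (\<tau> (Suc i)) = mirror (x (\<tau> i))"
      then have "fst (y (Suc i)) = fst (y i)" unfolding xi by (simp add: mirror_def)
      then show False using qneq[of i] yq[of i] yq[of "Suc i"] i by simp
    qed
  qed
  then show ?thesis by blast
qed

section \<open>Bound on the number of turns\<close>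

lemma T_X_pos_antimono:
  assumes "u1 > 0" "u1 < s" "s \<le> s'"
  shows "T_X u1 s' \<le> T_X u1 s" "T_X u1 s' > 0"
proof -
  have e: "(r + u1) / (r - u1) = 1 + 2 * u1 / (r - u1)" if "u1 < r" for r
    using that by (simp add: field_simps)
  define b where "b = 2 * u1 / (s - u1)"
  define b' where "b' = 2 * u1 / (s' - u1)"
  have "b' \<le> b" unfolding b_def b'_def using assms by (intro divide_left_mono) auto
  moreover have p: "b' > 0" "b > 0" using assms by (auto simp: b_def b'_def)
  ultimately have "\<not> arcosh (1 + b) < arcosh (1 + b')" by simp
  then have "arcosh (1 + b') \<le> arcosh (1 + b)" by (rule leI)
  moreover have "(s + u1) / (s - u1) = 1 + b" "(s' + u1) / (s' - u1) = 1 + b'"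
    using assms e[of s] e[of s'] by (simp_all add: b_def b'_def)
  ultimately have "arcosh ((s' + u1) / (s' - u1)) \<le> arcosh ((s + u1) / (s - u1))" by (simp only:)
  then show "T_X u1 s' \<le> T_X u1 s" using assms by (simp add: T_X_def divide_right_mono)
  have "T_X u1 s' = arcosh (1 + b') / (2 * sqrt u1)" using assms e[of s'] by (simp add: T_X_def b'_def)
  also have "\<dots> > 0" using p assms by (intro divide_pos_pos) simp_all
  finally show "T_X u1 s' > 0" .
qed

lemma T_Y_nonneg:
  assumes "s > 0" "u2 > 0" shows "T_Y u2 s \<ge> 0"
proof -
  have "arccos ((s - u2) / (s + u2)) \<le> pi" using assms by (intro arccos_ubound) (auto simp: divide_simps)
  then have "arccos ((s - u2) / (s + u2)) \<le> 2 * pi" using pi_ge_zero by linarith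
  then show ?thesis using assms by (simp add: T_Y_def)
qed

context turns begin

lemma turns_le:
  assumes "\<tau> (2 * n + 1) \<le> T" shows "int n \<le> \<lfloor>T / T_X u1 (s_plus u2)\<rfloor>"
proof -
  note TX = T_X_pos_antimono[OF _ s_gt s_le]
  have "\<tau> 0 \<le> \<tau> 1" "\<tau> (2 * n) \<le> \<tau> (2 * n + 1)"
    using bang_bang_times[OF segments, of 0 1] bang_bang_times[OF segments, of "2 * n" "2 * n + 1"] by simp_all
  moreover have "(real n - 1) * T_Y u2 s \<ge> 0"
    using n_ge_1 u s_gt T_Y_nonneg[of s u2] by simp
  ultimately have "real n * T_X u1 s \<le> T" using middle_time start assms by linarith
  moreover have "real n * T_X u1 (s_plus u2) \<le> real n * T_X u1 s" using TX u by (intro mult_left_mono) auto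
  ultimately have "real n \<le> T / T_X u1 (s_plus u2)" using TX u by (simp add: le_divide_eq)
  then show ?thesis by (simp add: le_floor_iff)
qed

lemma segment_times:
  assumes "i \<in> {1..<2 * n}"
  shows "\<tau> (i + 1) - \<tau> i = (if odd i then T_X u1 s else T_Y u2 s)"
  using X_segment(5)[of i] Y_segment(2)[of i] assms by simp

end

theorem theorem2:
  fixes u1 u2 \<gamma> :: real
  assumes "u1 \<ge> 1" and "u2 \<ge> 1" and "\<gamma> > 1"
  shows
    "((\<exists>\<tau> u x. XY_trajectory u1 u2 \<gamma> \<tau> u x) \<and>
      (\<forall>\<tau> u x. XY_trajectory u1 u2 \<gamma> \<tau> u x \<longrightarrow> \<tau> 2 = T_zero u1 u2 \<gamma>))
     \<and>
     (\<forall>n\<ge>1.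
        (\<exists>\<^sub>\<le>\<^sub>1 s. turn_equation u1 u2 \<gamma> n s) \<and>
        (\<forall>s. turn_equation u1 u2 \<gamma> n s \<longrightarrow> (\<exists>\<tau> u x. turn_trajectory u1 u2 \<gamma> n s \<tau> u x)) \<and>
        (\<forall>s \<tau> u x. turn_trajectory u1 u2 \<gamma> n s \<tau> u x \<longrightarrow>
           u1 < s \<and> s \<le> s_plus u2 \<and>
           (\<forall>t\<in>{\<tau> 0..\<tau> 1}. Y_first_integral u2 (x t) = c_first u2) \<and>
           (\<forall>t\<in>{\<tau> (2 * n)..\<tau> (2 * n + 1)}. Y_first_integral u2 (x t) = c_last u2 \<gamma>) \<and>
           (\<forall>i\<in>{1..<2 * n}. \<tau> (i + 1) - \<tau> i = (if odd i then T_X u1 s else T_Y u2 s)) \<and>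
           \<tau> (2 * n + 1) - \<tau> (2 * n) = T_F u2 \<gamma> s \<and>
           (turn_equation u1 u2 \<gamma> n s \<longleftrightarrow> inner_first_switching u2 (x (\<tau> 1))) \<and>
           (turn_equation u1 u2 \<gamma> n s \<longrightarrow>
              \<tau> 1 - \<tau> 0 = T_I u2 s \<and> \<tau> (2 * n + 1) = T_turns u1 u2 \<gamma> n s)))
     \<and>
     (\<forall>n\<ge>1. \<forall>s \<tau> u x.
        turn_trajectory u1 u2 \<gamma> n s \<tau> u x \<and> \<tau> (2 * n + 1) \<le> T_zero u1 u2 \<gamma> \<longrightarrow>
        int n \<le> \<lfloor>T_zero u1 u2 \<gamma> / T_X u1 (s_plus u2)\<rfloor>)"
proof (intro conjI)
  show "\<exists>\<tau> u x. XY_trajectory u1 u2 \<gamma> \<tau> u x" by (rule XY_trajectory_exists[OF assms])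
  show "\<forall>\<tau> u x. XY_trajectory u1 u2 \<gamma> \<tau> u x \<longrightarrow> \<tau> 2 = T_zero u1 u2 \<gamma>"
    using XY_trajectory_time[OF assms] by blast
next
  have turns: "turns u1 u2 \<gamma> s n \<tau> u x" if "turn_trajectory u1 u2 \<gamma> n s \<tau> u x" for n s \<tau> u x
    using assms that by unfold_locales
  show "\<forall>n\<ge>1. \<forall>s \<tau> u x.
        turn_trajectory u1 u2 \<gamma> n s \<tau> u x \<and> \<tau> (2 * n + 1) \<le> T_zero u1 u2 \<gamma> \<longrightarrow>
        int n \<le> \<lfloor>T_zero u1 u2 \<gamma> / T_X u1 (s_plus u2)\<rfloor>"
    using turns.turns_le[OF turns] by blast
  show "\<forall>n\<ge>1.
        (\<exists>\<^sub>\<le>\<^sub>1 s. turn_equation u1 u2 \<gamma> n s) \<and>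
        (\<forall>s. turn_equation u1 u2 \<gamma> n s \<longrightarrow> (\<exists>\<tau> u x. turn_trajectory u1 u2 \<gamma> n s \<tau> u x)) \<and>
        (\<forall>s \<tau> u x. turn_trajectory u1 u2 \<gamma> n s \<tau> u x \<longrightarrow>
           u1 < s \<and> s \<le> s_plus u2 \<and>
           (\<forall>t\<in>{\<tau> 0..\<tau> 1}. Y_first_integral u2 (x t) = c_first u2) \<and>
           (\<forall>t\<in>{\<tau> (2 * n)..\<tau> (2 * n + 1)}. Y_first_integral u2 (x t) = c_last u2 \<gamma>) \<and>
           (\<forall>i\<in>{1..<2 * n}. \<tau> (i + 1) - \<tau> i = (if odd i then T_X u1 s else T_Y u2 s)) \<and>
           \<tau> (2 * n + 1) - \<tau> (2 * n) = T_F u2 \<gamma> s \<and>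
           (turn_equation u1 u2 \<gamma> n s \<longleftrightarrow> inner_first_switching u2 (x (\<tau> 1))) \<and>
           (turn_equation u1 u2 \<gamma> n s \<longrightarrow>
              \<tau> 1 - \<tau> 0 = T_I u2 s \<and> \<tau> (2 * n + 1) = T_turns u1 u2 \<gamma> n s))"
  proof (rule allI, rule impI, intro conjI)
    fix n :: nat assume n: "n \<ge> 1"
    show "\<exists>\<^sub>\<le>\<^sub>1 s. turn_equation u1 u2 \<gamma> n s"
      using turn_equation_not_less[OF assms n] unfolding Uniq_def by (metis linorder_neqE_linordered_idom)
    show "\<forall>s. turn_equation u1 u2 \<gamma> n s \<longrightarrow> (\<exists>\<tau> u x. turn_trajectory u1 u2 \<gamma> n s \<tau> u x)"
      using turn_trajectory_exists[OF assms n] by blast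
    show "\<forall>s \<tau> u x. turn_trajectory u1 u2 \<gamma> n s \<tau> u x \<longrightarrow>
           u1 < s \<and> s \<le> s_plus u2 \<and>
           (\<forall>t\<in>{\<tau> 0..\<tau> 1}. Y_first_integral u2 (x t) = c_first u2) \<and>
           (\<forall>t\<in>{\<tau> (2 * n)..\<tau> (2 * n + 1)}. Y_first_integral u2 (x t) = c_last u2 \<gamma>) \<and>
           (\<forall>i\<in>{1..<2 * n}. \<tau> (i + 1) - \<tau> i = (if odd i then T_X u1 s else T_Y u2 s)) \<and>
           \<tau> (2 * n + 1) - \<tau> (2 * n) = T_F u2 \<gamma> s \<and>
           (turn_equation u1 u2 \<gamma> n s \<longleftrightarrow> inner_first_switching u2 (x (\<tau> 1))) \<and>
           (turn_equation u1 u2 \<gamma> n s \<longrightarrow>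
              \<tau> 1 - \<tau> 0 = T_I u2 s \<and> \<tau> (2 * n + 1) = T_turns u1 u2 \<gamma> n s)"
    proof (intro allI impI)
      fix s \<tau> u x assume tr: "turn_trajectory u1 u2 \<gamma> n s \<tau> u x"
      interpret turns u1 u2 \<gamma> s n \<tau> u x by (rule turns[OF tr])
      show "u1 < s \<and> s \<le> s_plus u2 \<and>
           (\<forall>t\<in>{\<tau> 0..\<tau> 1}. Y_first_integral u2 (x t) = c_first u2) \<and>
           (\<forall>t\<in>{\<tau> (2 * n)..\<tau> (2 * n + 1)}. Y_first_integral u2 (x t) = c_last u2 \<gamma>) \<and>
           (\<forall>i\<in>{1..<2 * n}. \<tau> (i + 1) - \<tau> i = (if odd i then T_X u1 s else T_Y u2 s)) \<and>
           \<tau> (2 * n + 1) - \<tau> (2 * n) = T_F u2 \<gamma> s \<and>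
           (turn_equation u1 u2 \<gamma> n s \<longleftrightarrow> inner_first_switching u2 (x (\<tau> 1))) \<and>
           (turn_equation u1 u2 \<gamma> n s \<longrightarrow>
              \<tau> 1 - \<tau> 0 = T_I u2 s \<and> \<tau> (2 * n + 1) = T_turns u1 u2 \<gamma> n s)"
        using s_gt s_le first_segment_integral last_segment_integral segment_times final_time
          turn_equation_iff initial_time total_time by blast
    qed
  qed
qed

end
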